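(* For every function $r:\mathbb N\to\mathbb R_{>0}$ with $r\in\Omega(\log n)$, there are families of $n$-vertex strongly hyperbolic uniform disk graphs (each containing graphs with arbitrarily large $n$) with disk radius in $\Theta(r)$ and, respectively, (i) clique number in $O(\log\log n)$, and both treewidth and row-treewidth in $\Omega(\log n)$; (ii) clique number in $O(1)$, and both treewidth and row-treewidth in $\Omega(\log\log n)$. That is, there is one such family satisfying (i), and one such family satisfying (ii).
   Context: Graphs are finite and simple. For $\rho>0$, a graph $G$ is a strongly hyperbolic uniform disk graph (SHUDG) with disk radius $\rho$ if its vertices can be assigned to points of the hyperbolic plane (of curvature $-1$), all at distance at most $2\rho$ from a fixed point (the origin), such that two distinct vertices are adjacent if and only if their points have hyperbolic distance at most $2\rho$. The clique number is the number of vertices of a largest complete subgraph. Asymptotics are with respect to the number $n$ of vertices, with $r=r(n)$: a family has disk radius in $\Theta(r)$ if there are constants $c_1,c_2>0$ such that every sufficiently large $n$-vertex graph $G$ of the family has such a representation with some disk radius $r_G$ with $c_1r(n)\le r_G\le c_2r(n)$; the statements on clique number, treewidth and row-treewidth are understood analogously. The strong product $G\boxtimes H$ has vertex set $V(G)\times V(H)$, and two distinct vertices $(u_G,u_H)$, $(v_G,v_H)$ are adjacent if and only if ($u_G=v_G$ or $u_Gv_G\in E(G)$) and ($u_H=v_H$ or $u_Hv_H\in E(H)$). The row-treewidth of $G$ is the smallest $t$ such that $G$ is (isomorphic to) a subgraph of $H\boxtimes P$ for some graph $H$ of treewidth $t$ and some path $P$. *)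

theory Defs
  imports Complex_Main "HOL-Library.Landau_Symbols" "Graph_Theory.Graph_Theory"
begin

text \<open>
  Finite simple graphs are the symmetric loop-free digraphs of \<^locale>\<open>pair_graph\<close>:
  an edge \<open>uv\<close> is the pair of arcs \<open>(u, v)\<close> and \<open>(v, u)\<close>.
\<close>

type_synonym 'a sgraph = "'a pair_pre_digraph"

abbreviation order_of :: "'a sgraph \<Rightarrow> nat" where
  "order_of G \<equiv> card (pverts G)"

definition clique_number :: "'a sgraph \<Rightarrow> nat" where
  "clique_number G =
     Max {k. \<exists>K :: 'a sgraph. subgraph (with_proj K) (with_proj G) \<and> complete_digraph k (with_proj K)}"


subsection \<open>Treewidth\<close>

text \<open>
  The constant \<^const>\<open>Digraph_Component.tree\<close> does not describe undirected trees: for a symmetric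
  digraph, \<^const>\<open>pre_digraph.cycle\<close> also holds of the closed walk along an edge and back.
  Cycles of an undirected simple graph are those of length at least 3.
\<close>

definition undirected_tree :: "'a sgraph \<Rightarrow> bool" where
  "undirected_tree T \<longleftrightarrow>
     pair_graph T \<and> Digraph_Component.connected (with_proj T) \<and>
     \<not> (\<exists>p. pre_digraph.cycle (with_proj T) p \<and> length p \<ge> 3)"

text \<open>
  Note that \<^const>\<open>Digraph_Component.connected\<close> implies nonemptiness, so the last condition below also
  says that every vertex lies in some bag.
\<close>

definition tree_decomposition :: "'a sgraph \<Rightarrow> 'b sgraph \<Rightarrow> ('b \<Rightarrow> 'a set) \<Rightarrow> bool" where
  "tree_decomposition G T B \<longleftrightarrow>
     undirected_tree T \<and>
     (\<Union>t \<in> pverts T. B t) = pverts G \<and>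
     (\<forall>(u, v) \<in> parcs G. \<exists>t \<in> pverts T. u \<in> B t \<and> v \<in> B t) \<and>
     (\<forall>v \<in> pverts G. Digraph_Component.connected (with_proj T \<restriction> {t \<in> pverts T. v \<in> B t}))"

definition decomposition_width :: "'b sgraph \<Rightarrow> ('b \<Rightarrow> 'a set) \<Rightarrow> nat" where
  "decomposition_width T B = Max ((\<lambda>t. card (B t)) ` pverts T) - 1"

text \<open>
  Decomposition trees are finite, so it suffices to consider trees on natural numbers. With the
  truncated subtraction above, the null graph gets treewidth 0 instead of \<open>-1\<close>.
\<close>

definition treewidth :: "'a sgraph \<Rightarrow> nat" where
  "treewidth G = (LEAST w. \<exists>(T :: nat sgraph) B.
     tree_decomposition G T B \<and> decomposition_width T B = w)"


subsection \<open>Row-treewidth\<close>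

definition strong_product :: "'a sgraph \<Rightarrow> 'b sgraph \<Rightarrow> ('a \<times> 'b) sgraph"  (infixl \<open>\<boxtimes>\<close> 70) where
  "G \<boxtimes> H =
     \<lparr>pverts = pverts G \<times> pverts H,
      parcs = {((u, x), (v, y)). u \<in> pverts G \<and> v \<in> pverts G \<and> x \<in> pverts H \<and> y \<in> pverts H \<and>
        (u, x) \<noteq> (v, y) \<and> (u = v \<or> (u, v) \<in> parcs G) \<and> (x = y \<or> (x, y) \<in> parcs H)}\<rparr>"

text \<open>The path with \<open>m\<close> edges.\<close>

definition path_graph :: "nat \<Rightarrow> nat sgraph" where
  "path_graph m =
     \<lparr>pverts = {0..m}, parcs = {(i, j). i \<le> m \<and> j \<le> m \<and> (j = Suc i \<or> i = Suc j)}\<rparr>"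

definition subgraph_up_to_iso :: "'a sgraph \<Rightarrow> 'b sgraph \<Rightarrow> bool" where
  "subgraph_up_to_iso G X \<longleftrightarrow>
     (\<exists>S :: 'b sgraph. subgraph (with_proj S) (with_proj X) \<and> digraph_iso (with_proj G) (with_proj S))"

definition row_treewidth :: "'a sgraph \<Rightarrow> nat" where
  "row_treewidth G = (LEAST t. \<exists>(H :: nat sgraph) m.
     pair_graph H \<and> treewidth H = t \<and> subgraph_up_to_iso G (H \<boxtimes> path_graph m))"


subsection \<open>Strongly hyperbolic uniform disk graphs\<close>

text \<open>
  The hyperbolic plane of curvature \<open>-1\<close> is the open unit disk with the Poincare metric
  \<open>2 \<bar>dz\<bar> / (1 - \<bar>z\<bar>\<^sup>2)\<close>; the origin is \<open>0\<close>.
\<close>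

definition hyp_plane :: "complex set" where
  "hyp_plane = {z. cmod z < 1}"

definition hyp_dist :: "complex \<Rightarrow> complex \<Rightarrow> real" where
  "hyp_dist z w =
     arcosh (1 + 2 * (cmod (z - w))\<^sup>2 / ((1 - (cmod z)\<^sup>2) * (1 - (cmod w)\<^sup>2)))"

text \<open>
  The point with hyperbolic polar coordinates \<open>(a, \<phi>)\<close> is \<open>tanh (a / 2) * cis \<phi>\<close>, and in
  these coordinates the distance is given by the hyperbolic law of cosines.
\<close>

lemma hyp_dist_polar:
  fixes a b \<phi> \<psi> :: real
  defines "z \<equiv> complex_of_real (tanh (a / 2)) * cis \<phi>"
    and "w \<equiv> complex_of_real (tanh (b / 2)) * cis \<psi>"
  shows "hyp_dist z w = arcosh (cosh a * cosh b - sinh a * sinh b * cos (\<phi> - \<psi>))"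
proof -
  define c s d t where "c = cosh (a / 2)" and "s = sinh (a / 2)"
    and "d = cosh (b / 2)" and "t = sinh (b / 2)"
  define k where "k = cos (\<phi> - \<psi>)"
  have pos: "c > 0" "d > 0" by (simp_all add: c_def d_def)
  have cs: "c\<^sup>2 = s\<^sup>2 + 1" "d\<^sup>2 = t\<^sup>2 + 1"
    by (simp_all add: c_def s_def d_def t_def cosh_square_eq)
  have ca: "cosh a = 2 * s\<^sup>2 + 1" "sinh a = 2 * s * c"
    using cosh_double[of "a / 2"] sinh_double[of "a / 2"] cs(1)
    by (simp_all add: c_def s_def)
  have cb: "cosh b = 2 * t\<^sup>2 + 1" "sinh b = 2 * t * d"
    using cosh_double[of "b / 2"] sinh_double[of "b / 2"] cs(2)
    by (simp_all add: d_def t_def)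
  have tz: "tanh (a / 2) = s / c" and tw: "tanh (b / 2) = t / d"
    by (simp_all add: tanh_def c_def s_def d_def t_def)
  have nz: "(cmod z)\<^sup>2 = (s / c)\<^sup>2" and nw: "(cmod w)\<^sup>2 = (t / d)\<^sup>2"
    by (simp_all add: z_def w_def norm_mult norm_divide power_divide tz tw)
  have k: "k = cos \<phi> * cos \<psi> + sin \<phi> * sin \<psi>"
    by (simp add: k_def cos_diff)
  have "(cmod (z - w))\<^sup>2 =
      (s / c * cos \<phi> - t / d * cos \<psi>)\<^sup>2 + (s / c * sin \<phi> - t / d * sin \<psi>)\<^sup>2"
    by (simp add: cmod_power2 z_def w_def tz tw)
  also have "\<dots> = (s / c)\<^sup>2 * ((cos \<phi>)\<^sup>2 + (sin \<phi>)\<^sup>2) + (t / d)\<^sup>2 * ((cos \<psi>)\<^sup>2 + (sin \<psi>)\<^sup>2)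
      - 2 * (s / c) * (t / d) * k"
    unfolding k by (simp only: power2_eq_square) algebra
  finally have nd: "(cmod (z - w))\<^sup>2 = (s / c)\<^sup>2 + (t / d)\<^sup>2 - 2 * (s / c) * (t / d) * k"
    by simp
  have "1 - (s / c)\<^sup>2 = 1 / c\<^sup>2" "1 - (t / d)\<^sup>2 = 1 / d\<^sup>2"
  proof -
    have "s\<^sup>2 = c\<^sup>2 - 1" "t\<^sup>2 = d\<^sup>2 - 1" using cs by simp_all
    then show "1 - (s / c)\<^sup>2 = 1 / c\<^sup>2" "1 - (t / d)\<^sup>2 = 1 / d\<^sup>2"
      using pos by (simp_all add: power_divide diff_divide_distrib)
  qed
  then have "1 + 2 * (cmod (z - w))\<^sup>2 / ((1 - (cmod z)\<^sup>2) * (1 - (cmod w)\<^sup>2)) =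
      1 + 2 * ((s / c)\<^sup>2 + (t / d)\<^sup>2 - 2 * (s / c) * (t / d) * k) * (c\<^sup>2 * d\<^sup>2)"
    by (simp add: nz nw nd)
  also have "\<dots> = 1 + 2 * (s\<^sup>2 * d\<^sup>2 + t\<^sup>2 * c\<^sup>2 - 2 * s * t * c * d * k)"
    using pos by (simp add: power2_eq_square field_simps)
  also have "\<dots> = cosh a * cosh b - sinh a * sinh b * k"
    unfolding ca cb cs by (simp add: algebra_simps)
  finally show ?thesis by (simp add: hyp_dist_def k_def)
qed

definition shudg :: "real \<Rightarrow> 'a sgraph \<Rightarrow> bool" where
  "shudg \<rho> G \<longleftrightarrow>
     pair_graph G \<and> \<rho> > 0 \<and>
     (\<exists>p. p ` pverts G \<subseteq> hyp_plane \<and>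
          (\<forall>v \<in> pverts G. hyp_dist 0 (p v) \<le> 2 * \<rho>) \<and>
          (\<forall>u \<in> pverts G. \<forall>v \<in> pverts G.
             u \<noteq> v \<longrightarrow> ((u, v) \<in> parcs G \<longleftrightarrow> hyp_dist (p u) (p v) \<le> 2 * \<rho>)))"


subsection \<open>Families of graphs and their asymptotics\<close>

definition shudg_family :: "'a sgraph set \<Rightarrow> bool" where
  "shudg_family \<G> \<longleftrightarrow>
     (\<forall>G \<in> \<G>. \<exists>\<rho>. shudg \<rho> G) \<and> (\<forall>N. \<exists>G \<in> \<G>. order_of G \<ge> N)"

text \<open>
  The filter of the sufficiently large members of a family. Landau symbols with respect to it are
  uniform over all members of the family, and their right-hand sides are functions of the order.
\<close>

definition large_in :: "'a sgraph set \<Rightarrow> 'a sgraph filter" where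
  "large_in \<G> = inf (filtercomap order_of at_top) (principal \<G>)"

lemma eventually_large_in:
  "eventually P (large_in \<G>) \<longleftrightarrow> (\<exists>N. \<forall>G \<in> \<G>. order_of G \<ge> N \<longrightarrow> P G)"
  unfolding large_in_def eventually_inf_principal eventually_filtercomap eventually_at_top_linorder
  by (metis (mono_tags, lifting))

definition disk_radius_Theta :: "'a sgraph set \<Rightarrow> (nat \<Rightarrow> real) \<Rightarrow> bool" where
  "disk_radius_Theta \<G> r \<longleftrightarrow>
     (\<exists>c1 > 0. \<exists>c2 > 0. \<forall>\<^sub>F G in large_in \<G>. \<exists>\<rho>. shudg \<rho> G \<and>
        c1 * r (order_of G) \<le> \<rho> \<and> \<rho> \<le> c2 * r (order_of G))"

end

theory Submission
  imports Defs "HOL-Library.Discrete_Functions" "HOL-Real_Asymp.Real_Asymp"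
begin

text \<open>
  Both families consist of graphs with one common design. In hyperbolic polar coordinates with disk
  radius \<open>\<rho>\<close>, put \<open>2\<^sup>l\<close> points equally spaced on a fixed arc of the circle of radius
  \<open>\<rho> + l * ln 2\<close>; call this the ring of level \<open>l\<close>. By the law of cosines, points at levels
  \<open>l\<close> and \<open>m\<close> with angle difference \<open>\<delta>\<close> are adjacent, up to constant factors, iff
  \<open>\<delta> \<le> 2\<^bsup>-(l+m)/2\<^esup>\<close>. Consecutive points of a ring have distance \<open>2\<^bsup>-l\<^esup>\<close>, so every ring is
  connected, and the point of ring \<open>m\<close> that is closest to a point of a ring \<open>l < m\<close> is its neighbour.
  Hence the rings of a set \<open>L\<close> of levels are the branch sets of a clique minor, and the
  treewidth is at least \<open>card L - 1\<close>. The origin is added as one more vertex. It is universal,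
  because all points lie within distance \<open>2 * \<rho>\<close> of it; therefore an embedding into \<open>H \<boxtimes> P\<close>
  uses at most three rows of \<open>P\<close>, which gives \<open>tw \<le> 3 * rtw + 2\<close>, so that lower bounds on
  the treewidth carry over to the row-treewidth.

  Cliques are small because the points sit at odd multiples of \<open>2\<^bsup>-l-1\<^esup>\<close>: two points at levels
  \<open>l \<le> m\<close> differ by at least \<open>2\<^bsup>-m-1\<^esup>\<close>. In a clique whose deepest vertex has level \<open>M\<close>
  both are within \<open>O(2\<^bsup>-(l+M)/2\<^esup>)\<close> of that vertex, and this forces
  \<open>M - m \<le> (M - l) / 2 + O(1)\<close>. So the depths \<open>M - l\<close> that occur in a clique at least halve from one
  to the next, up to an additive constant, and only constantly many vertices have small depth.

  For (i) take all levels \<open>0, \<dots>, k\<close>. Then \<open>ln n\<close> is of order \<open>k\<close>, there are \<open>k + 1\<close> rings, and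
  halving leaves cliques of size \<open>O(ln k)\<close>. For (ii) take the levels \<open>4\<^sup>i\<close> with \<open>i \<le> k\<close>. Then
  \<open>ln n\<close> is of order \<open>4\<^sup>k\<close>, there are again \<open>k + 1\<close> rings, but now all positive depths are at
  least \<open>3 * M / 4\<close>, so they cannot halve and cliques have bounded size. The levels only have to
  satisfy \<open>l * ln 2 \<le> \<rho>\<close>, which leaves room for every radius above \<open>ln n\<close>: the choice
  \<open>\<rho> = r n + ln n + 2\<close> is of order \<open>r n\<close> since \<open>r\<close> grows at least like \<open>ln n\<close>.

  The bound on treewidth through clique minors rests on the Helly property of subtrees,
  \<open>subtrees_Helly\<close>.
\<close>

section \<open>Connected vertex sets and subtrees of trees\<close>

text \<open>
  \<^const>\<open>Digraph_Component.connected\<close> speaks of a graph; here the vertex set of the induced subgraph is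
  the variable and the arcs stay fixed, so that walks avoiding a vertex \<open>t\<close> are those in
  \<open>rtrancl_on (V - {t}) E\<close>.
\<close>

definition connected_in :: "'a rel \<Rightarrow> 'a set \<Rightarrow> bool" where
  "connected_in E S \<longleftrightarrow> S \<noteq> {} \<and> (\<forall>u \<in> S. \<forall>v \<in> S. (u, v) \<in> rtrancl_on S E)"

lemma rtrancl_on_Int_square: "rtrancl_on S (E \<inter> S \<times> S) = rtrancl_on S E"
proof (rule set_eqI, clarify)
  fix u v
  have "(u, v) \<in> rtrancl_on S (E \<inter> S \<times> S)" if "(u, v) \<in> rtrancl_on S E"
    using that by (induction rule: rtrancl_on_induct) (auto intro: rtrancl_on_into_rtrancl_on)
  then show "(u, v) \<in> rtrancl_on S (E \<inter> S \<times> S) \<longleftrightarrow> (u, v) \<in> rtrancl_on S E"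
    by (auto elim: rtrancl_on_mono[rotated 2])
qed

lemma connected_induced_iff:
  assumes "pair_graph T"
  shows "Digraph_Component.connected (with_proj T \<restriction> S) \<longleftrightarrow> connected_in (parcs T) S"
proof -
  interpret pair_graph T by fact
  have "parcs (mk_symmetric (with_proj T \<restriction> S)) = parcs T \<inter> S \<times> S"
    by (auto simp: parcs_mk_symmetric dest: arcs_symmetric)
  then show ?thesis
    by (simp add: Digraph_Component.connected_def strongly_connected_def reachable_def
        connected_in_def rtrancl_on_Int_square)
qed

lemma connected_iff:
  assumes "pair_graph T"
  shows "Digraph_Component.connected (with_proj T) \<longleftrightarrow> connected_in (parcs T) (pverts T)"
proof -
  interpret pair_graph T by fact
  have "with_proj T \<restriction> pverts T = with_proj T"
    by (auto simp: induce_subgraph_def with_proj_def dest: in_arcsD1 in_arcsD2)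
  with connected_induced_iff[OF assms, of "pverts T"] show ?thesis by simp
qed

text \<open>
  No vertex \<open>u\<close> can be reached from both ends of a tree edge \<open>st\<close> without using the other end:
  otherwise \<open>s\<close> and \<open>t\<close> would remain connected after removing the edge, and a path between them would
  close up with the edge to a cycle.
\<close>

lemma tree_edge_separates:
  assumes T: "undirected_tree T" and st: "(s, t) \<in> parcs T"
    and su: "(s, u) \<in> rtrancl_on (pverts T - {t}) (parcs T)"
    and ut: "(u, t) \<in> rtrancl_on (pverts T - {s}) (parcs T)"
  shows False
proof -
  interpret pair_graph T using T by (simp add: undirected_tree_def)
  define T' where "T' = T\<lparr>parcs := parcs T - {(s, t), (t, s)}\<rparr>"
  have T'[simp]: "pverts T' = pverts T" "parcs T' = parcs T - {(s, t), (t, s)}"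
    by (simp_all add: T'_def)
  interpret T': pair_wf_digraph T'
    by unfold_locales (auto simp: in_arcsD1 in_arcsD2)
  have sub: "subgraph (with_proj T') (with_proj T)"
    by (auto simp: subgraph_def wf_digraph_wp_iff T'.pair_wf_digraph_axioms pair_wf_digraph)
  have a: "(x, y) \<in> rtrancl_on (pverts T) (parcs T')" if "z \<in> {s, t}"
    "(x, y) \<in> rtrancl_on (pverts T - {z}) (parcs T)" for x y z
    using that(2)
  proof (induction rule: rtrancl_on_induct)
    case (step y w)
    have "(y, w) \<in> parcs T'" using step that(1) by auto
    with step show ?case by (auto intro: rtrancl_on_into_rtrancl_on)
  qed auto
  have "(s, t) \<in> rtrancl_on (pverts T) (parcs T')"
    by (rule rtrancl_on_trans[OF a[OF _ su] a[OF _ ut]]) auto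
  then have "s \<rightarrow>\<^sup>*\<^bsub>with_proj T'\<^esub> t" by (simp add: reachable_def)
  then obtain p where p': "T'.apath s p t" by (auto simp: T'.reachable_apath)
  then have p: "apath s p t" using subgraph_apath_imp_apath[OF _ sub] by blast
  have ts: "(t, s) \<in> parcs T" and "s \<noteq> t" using st no_loops' arcs_symmetric by blast+
  \<comment> \<open>the edge itself is not available in \<open>T'\<close>, so the cycle below has at least three arcs\<close>
  have "length p \<ge> 2"
  proof (rule ccontr)
    assume "\<not> length p \<ge> 2"
    then consider "p = []" | e where "p = [e]"
      by (metis One_nat_def Suc_1 Suc_leI length_0_conv length_Suc_conv less_one linorder_not_less nat_neq_iff not_less_eq)
    then show False
    proof cases
      case 1 with p \<open>s \<noteq> t\<close> show False by (simp add: apath_Nil_iff)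
    next
      case 2 with p' show False
        by (cases e) (auto simp: T'.apath_Cons_iff T'.apath_Nil_iff)
    qed
  qed
  then have "length ((t, s) # p) \<ge> 3" by simp
  moreover have "cycle ((t, s) # p)"
    unfolding cycle_def
  proof (intro exI conjI)
    show "awalk t ((t, s) # p) t" using p ts by (auto simp: apath_def awalk_Cons_iff)
    show "distinct (tl (awalk_verts t ((t, s) # p)))" using p by (simp add: apath_def)
  qed simp
  ultimately show False using T by (auto simp: undirected_tree_def)
qed

lemma rtrancl_on_last_step:
  assumes "(u, t) \<in> rtrancl_on V E" "u \<noteq> t"
  obtains s where "(u, s) \<in> rtrancl_on (V - {t}) E" "(s, t) \<in> E" "s \<in> V"
proof -
  have "\<exists>s. (u, s) \<in> rtrancl_on (V - {t}) E \<and> (s, t) \<in> E \<and> s \<in> V"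
    using assms
  proof induction
    case (step x y)
    show ?case
    proof (cases "y = t")
      case True
      with step show ?thesis by (intro exI[of _ x]) auto
    next
      case False
      with step show ?thesis
        by (auto intro: converse_rtrancl_on_into_rtrancl_on)
    qed
  qed simp
  then show ?thesis using that by blast
qed

lemma rtrancl_on_avoids_unreachable:
  assumes "(u, x) \<in> rtrancl_on (V - A) E" "\<And>t. t \<in> B \<Longrightarrow> (u, t) \<notin> rtrancl_on (V - A) E"
  shows "(u, x) \<in> rtrancl_on (V - B) E"
  using assms(1)
proof (induction rule: rtrancl_on_induct)
  case base
  then show ?case using assms(2)[of u] by auto
next
  case (step y z)
  then have "(u, z) \<in> rtrancl_on (V - A) E" by (auto intro: rtrancl_on_into_rtrancl_on)
  then have "z \<notin> B" using assms(2) by blast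
  with step show ?case by (auto intro: rtrancl_on_into_rtrancl_on)
qed

text \<open>
  If every vertex is missed by some subtree, then each pair of a vertex \<open>t\<close> and a subtree \<open>S i\<close> missing
  it points to the component of \<open>T - t\<close> that contains \<open>S i\<close>. Take a pair with the smallest component
  and step from \<open>t\<close> to its neighbour \<open>s\<close> in there. A subtree that misses \<open>s\<close> meets \<open>S i\<close>, and since
  the edge \<open>st\<close> separates, its component in \<open>T - s\<close> lies in the previous one but lacks \<open>s\<close>,
  contradicting minimality.
\<close>

theorem subtrees_Helly:
  assumes T: "undirected_tree T"
    and conn: "\<And>i. i \<in> I \<Longrightarrow> connected_in (parcs T) (S i)"
    and sub: "\<And>i. i \<in> I \<Longrightarrow> S i \<subseteq> pverts T"
    and meet: "\<And>i j. i \<in> I \<Longrightarrow> j \<in> I \<Longrightarrow> S i \<inter> S j \<noteq> {}"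
  shows "\<exists>t \<in> pverts T. \<forall>i \<in> I. t \<in> S i"
proof (rule ccontr)
  assume none: "\<not> ?thesis"
  interpret pair_graph T using T by (simp add: undirected_tree_def)
  define V E where "V = pverts T" and "E = parcs T"
  have VE: "V \<noteq> {}" "\<And>u v. u \<in> V \<Longrightarrow> v \<in> V \<Longrightarrow> (u, v) \<in> rtrancl_on V E"
    using T connected_iff[OF pair_graph]
    by (auto simp: undirected_tree_def connected_in_def V_def E_def)
  have "sym E" unfolding E_def by (auto intro: symI arcs_symmetric)
  then have rev: "(y, x) \<in> rtrancl_on A E" if "(x, y) \<in> rtrancl_on A E" for x y A
    using that rtrancl_on_sym symD by metis
  have inS: "(u, v) \<in> rtrancl_on (V - {t}) E" if "i \<in> I" "u \<in> S i" "v \<in> S i" "t \<notin> S i" for u v t i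
  proof -
    have "(u, v) \<in> rtrancl_on (S i) E"
      using conn[OF that(1)] that by (auto simp: connected_in_def E_def)
    moreover have "S i \<subseteq> V - {t}" using sub[OF that(1)] that by (auto simp: V_def)
    ultimately show ?thesis by (rule rtrancl_on_mono[OF order_refl, rotated])
  qed
  define C where "C = (\<lambda>(t, i). {x. \<exists>u \<in> S i. (u, x) \<in> rtrancl_on (V - {t}) E})"
  define P where "P = (\<lambda>(t, i). t \<in> V \<and> i \<in> I \<and> t \<notin> S i)"
  have missed: "\<exists>i. P (t, i)" if "t \<in> V" for t
    using none that by (auto simp: V_def P_def)
  with VE(1) have "\<exists>k. P k" by blast
  then obtain k where "P k" and least: "\<And>l. P l \<Longrightarrow> card (C k) \<le> card (C l)"
    using ex_has_least_nat[of P _ "\<lambda>k. card (C k)"] by metis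
  then obtain t i where ti: "k = (t, i)" "t \<in> V" "i \<in> I" "t \<notin> S i"
    by (cases k) (auto simp: P_def)
  obtain u0 where u0: "u0 \<in> S i" using conn[OF ti(3)] by (auto simp: connected_in_def)
  have "u0 \<in> V" "u0 \<noteq> t" using u0 ti sub by (auto simp: V_def)
  then obtain s where s: "(u0, s) \<in> rtrancl_on (V - {t}) E" "(s, t) \<in> E" "s \<in> V"
    using rtrancl_on_last_step[OF VE(2)[OF \<open>u0 \<in> V\<close> ti(2)]] by metis
  from missed[OF s(3)] obtain j where j: "j \<in> I" "s \<notin> S j" by (auto simp: P_def)
  obtain u where u: "u \<in> S i" "u \<in> S j" using meet[OF ti(3) j(1)] by blast
  have "(s, u) \<in> rtrancl_on (V - {t}) E"
    using rtrancl_on_trans[OF rev[OF s(1)] inS[OF ti(3) u0 u(1) ti(4)]] .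
  then have ut: "(u, t) \<notin> rtrancl_on (V - {s}) E"
    using tree_edge_separates[OF T, of s t u] s(2) by (auto simp: V_def E_def)
  have "C (s, j) \<subseteq> C (t, i)"
  proof
    fix x assume "x \<in> C (s, j)"
    then obtain w where w: "w \<in> S j" "(w, x) \<in> rtrancl_on (V - {s}) E" by (auto simp: C_def)
    have "(u, x) \<in> rtrancl_on (V - {s}) E"
      using rtrancl_on_trans[OF inS[OF j(1) u(2) w(1) j(2)] w(2)] .
    then have "(u, x) \<in> rtrancl_on (V - {t}) E"
      using rtrancl_on_avoids_unreachable[of u x V "{s}" E "{t}"] ut by blast
    then show "x \<in> C (t, i)" using u by (auto simp: C_def)
  qed
  moreover have "s \<in> C (t, i)" using s(1) u0 by (auto simp: C_def)
  moreover have "s \<notin> C (s, j)" by (auto simp: C_def dest: in_rtrancl_on_in_F)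
  ultimately have "C (s, j) \<subset> C (t, i)" by blast
  moreover have "C (t, i) \<subseteq> V" by (auto simp: C_def dest: in_rtrancl_on_in_F)
  then have "finite (C (t, i))" using pair_finite_verts by (auto simp: V_def intro: finite_subset)
  ultimately have "card (C (s, j)) < card (C k)" using ti(1) by (simp add: psubset_card_mono)
  moreover have "P (s, j)" using s j by (simp add: P_def)
  ultimately show False using least by fastforce
qed

section \<open>Clique minors and treewidth\<close>

text \<open>
  Along a walk in \<open>R\<close>, the subtrees of nodes whose bags contain the successive vertices overlap,
  because each edge lies in a bag; hence their union is connected.
\<close>

lemma bag_trace_connected:
  assumes G: "pair_graph G" and dec: "tree_decomposition G T B"
    and R: "connected_in (parcs G) R" "R \<subseteq> pverts G"
  shows "connected_in (parcs T) {t \<in> pverts T. B t \<inter> R \<noteq> {}}" (is "connected_in _ ?T")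
proof -
  have T: "pair_graph T" using dec by (simp add: tree_decomposition_def undirected_tree_def)
  have bags: "connected_in (parcs T) {t \<in> pverts T. v \<in> B t}" if "v \<in> R" for v
    using dec that R(2) connected_induced_iff[OF T] by (auto simp: tree_decomposition_def)
  have same: "(a, b) \<in> rtrancl_on ?T (parcs T)"
    if "a \<in> pverts T" "b \<in> pverts T" "v \<in> B a" "v \<in> B b" "v \<in> R" for a b v
  proof -
    have "(a, b) \<in> rtrancl_on {t \<in> pverts T. v \<in> B t} (parcs T)"
      using bags[OF that(5)] that by (auto simp: connected_in_def)
    then show ?thesis by (rule rtrancl_on_mono[rotated 2]) (use that in auto)
  qed
  have path: "\<forall>b \<in> pverts T. v \<in> B b \<longrightarrow> (a, b) \<in> rtrancl_on ?T (parcs T)"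
    if "(u, v) \<in> rtrancl_on R (parcs G)" "a \<in> pverts T" "u \<in> B a" for u v a
    using that(1)
  proof (induction rule: rtrancl_on_induct)
    case base
    then show ?case using same that by blast
  next
    case (step y z)
    then obtain c where c: "c \<in> pverts T" "y \<in> B c" "z \<in> B c"
      using dec by (auto simp: tree_decomposition_def)
    then have "(a, c) \<in> rtrancl_on ?T (parcs T)" using step by blast
    then show ?case using same[OF c(1) _ c(3)] step by (blast intro: rtrancl_on_trans)
  qed
  obtain v where v: "v \<in> R" using R(1) by (auto simp: connected_in_def)
  have "?T \<noteq> {}" using bags[OF v] v by (auto simp: connected_in_def)
  moreover have "(a, b) \<in> rtrancl_on ?T (parcs T)" if ab: "a \<in> ?T" "b \<in> ?T" for a b
  proof -
    from ab obtain u v where "u \<in> B a" "u \<in> R" "v \<in> B b" "v \<in> R" by blast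
    moreover from this have "(u, v) \<in> rtrancl_on R (parcs G)"
      using R(1) by (simp add: connected_in_def)
    ultimately show ?thesis using path ab by blast
  qed
  ultimately show ?thesis by (auto simp: connected_in_def)
qed

text \<open>
  The traces of the branch sets are pairwise intersecting subtrees, so some bag meets all of them, and
  it meets them in different vertices.
\<close>

lemma clique_minor_meets_bag:
  assumes G: "pair_graph G" and dec: "tree_decomposition G T B" and "finite I"
    and conn: "\<And>i. i \<in> I \<Longrightarrow> connected_in (parcs G) (R i)"
    and sub: "\<And>i. i \<in> I \<Longrightarrow> R i \<subseteq> pverts G"
    and disj: "\<And>i j. i \<in> I \<Longrightarrow> j \<in> I \<Longrightarrow> i \<noteq> j \<Longrightarrow> R i \<inter> R j = {}"
    and adj: "\<And>i j. i \<in> I \<Longrightarrow> j \<in> I \<Longrightarrow> i \<noteq> j \<Longrightarrow> \<exists>u \<in> R i. \<exists>v \<in> R j. (u, v) \<in> parcs G"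
  shows "\<exists>t \<in> pverts T. card I \<le> card (B t)"
proof -
  interpret pair_graph G by fact
  let ?S = "\<lambda>i. {t \<in> pverts T. B t \<inter> R i \<noteq> {}}"
  have S: "connected_in (parcs T) (?S i)" if "i \<in> I" for i
    by (rule bag_trace_connected[OF G dec conn[OF that] sub[OF that]])
  have "\<exists>t \<in> pverts T. \<forall>i \<in> I. t \<in> ?S i"
  proof (rule subtrees_Helly[where S = ?S])
    show "undirected_tree T" using dec by (simp add: tree_decomposition_def)
    show "?S i \<inter> ?S j \<noteq> {}" if ij: "i \<in> I" "j \<in> I" for i j
    proof (cases "i = j")
      case True
      then show ?thesis using S[OF ij(1)] by (auto simp: connected_in_def)
    next
      case False
      then obtain u v where "u \<in> R i" "v \<in> R j" "(u, v) \<in> parcs G" using adj ij by blast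
      moreover from this obtain t where "t \<in> pverts T" "u \<in> B t" "v \<in> B t"
        using dec by (auto simp: tree_decomposition_def)
      ultimately show ?thesis by blast
    qed
  qed (use S in auto)
  then obtain t where t: "t \<in> pverts T" "\<And>i. i \<in> I \<Longrightarrow> B t \<inter> R i \<noteq> {}" by blast
  then have "\<forall>i \<in> I. \<exists>v. v \<in> B t \<inter> R i" by blast
  then obtain f where f: "\<And>i. i \<in> I \<Longrightarrow> f i \<in> B t \<inter> R i" by metis
  have "inj_on f I"
  proof (rule inj_onI, rule ccontr)
    fix i j assume "i \<in> I" "j \<in> I" "f i = f j" "i \<noteq> j"
    then show False using f[of i] f[of j] disj[of i j] by auto
  qed
  moreover have "f ` I \<subseteq> B t" using f by auto
  moreover have "B t \<subseteq> pverts G" using dec t by (auto simp: tree_decomposition_def)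
  then have "finite (B t)" using pair_finite_verts by (rule finite_subset)
  ultimately have "card I \<le> card (B t)" by (metis card_inj_on_le)
  then show ?thesis using t by blast
qed

lemma card_bag_le:
  assumes "tree_decomposition G T B" "t \<in> pverts T"
  shows "card (B t) \<le> decomposition_width T B + 1"
proof -
  interpret pair_graph T using assms by (simp add: tree_decomposition_def undirected_tree_def)
  have "card (B t) \<le> Max ((\<lambda>t. card (B t)) ` pverts T)"
    using assms(2) pair_finite_verts by (intro Max_ge) auto
  then show ?thesis by (simp add: decomposition_width_def)
qed

lemma decomposition_width_leI:
  assumes "undirected_tree T" "\<And>t. t \<in> pverts T \<Longrightarrow> card (B t) \<le> k + 1"
  shows "decomposition_width T B \<le> k"
proof -
  interpret pair_graph T using assms by (simp add: undirected_tree_def)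
  have "pverts T \<noteq> {}"
    using assms(1) connected_iff[OF pair_graph] by (auto simp: undirected_tree_def connected_in_def)
  then have "Max ((\<lambda>t. card (B t)) ` pverts T) \<le> k + 1"
    using assms(2) pair_finite_verts by (intro Max.boundedI) auto
  then show ?thesis by (simp add: decomposition_width_def)
qed

lemma treewidth_le_decomposition_width:
  fixes T :: "nat sgraph"
  assumes "tree_decomposition G T B"
  shows "treewidth G \<le> decomposition_width T B"
  unfolding treewidth_def by (rule Least_le) (use assms in blast)

lemma obtain_optimal_tree_decomposition:
  assumes "pair_graph G"
  obtains T :: "nat sgraph" and B where
    "tree_decomposition G T B" "decomposition_width T B = treewidth G"
proof -
  \<comment> \<open>a single bag with all vertices shows that some tree decomposition exists\<close>
  define T :: "nat sgraph" where "T = \<lparr>pverts = {0}, parcs = {}\<rparr>"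
  have T: "pair_graph T" by unfold_locales (auto simp: T_def symmetric_def sym_def)
  have "\<not> pre_digraph.cycle (with_proj T) p" if "length p \<ge> 3" for p
    using that by (auto simp: pre_digraph.cycle_def pre_digraph.awalk_def T_def)
  then have tree: "undirected_tree T"
    using T by (auto simp: undirected_tree_def connected_iff connected_in_def T_def)
  have "connected_in (parcs T) {t \<in> pverts T. v \<in> pverts G}" if "v \<in> pverts G" for v
    using that by (auto simp: T_def connected_in_def)
  then have "tree_decomposition G T (\<lambda>_. pverts G)"
    using tree connected_induced_iff[OF T] assms
    by (auto simp: tree_decomposition_def T_def pair_graph_def pair_digraph_def pair_fin_digraph_def
        pair_wf_digraph_def)
  then have "\<exists>w (T :: nat sgraph) B. tree_decomposition G T B \<and> decomposition_width T B = w"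
    by blast
  then have "\<exists>(T :: nat sgraph) B. tree_decomposition G T B \<and> decomposition_width T B = treewidth G"
    unfolding treewidth_def by (rule LeastI_ex)
  then show ?thesis using that by blast
qed

theorem treewidth_ge_clique_minor:
  assumes "pair_graph G" and "finite I"
    and "\<And>i. i \<in> I \<Longrightarrow> connected_in (parcs G) (R i)"
    and "\<And>i. i \<in> I \<Longrightarrow> R i \<subseteq> pverts G"
    and "\<And>i j. i \<in> I \<Longrightarrow> j \<in> I \<Longrightarrow> i \<noteq> j \<Longrightarrow> R i \<inter> R j = {}"
    and "\<And>i j. i \<in> I \<Longrightarrow> j \<in> I \<Longrightarrow> i \<noteq> j \<Longrightarrow> \<exists>u \<in> R i. \<exists>v \<in> R j. (u, v) \<in> parcs G"
  shows "card I \<le> treewidth G + 1"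
proof -
  obtain T :: "nat sgraph" and B where
    TB: "tree_decomposition G T B" "decomposition_width T B = treewidth G"
    using obtain_optimal_tree_decomposition[OF assms(1)] by metis
  have "\<exists>t \<in> pverts T. card I \<le> card (B t)"
    by (rule clique_minor_meets_bag[where R = R]) (fact assms TB)+
  then obtain t where "t \<in> pverts T" "card I \<le> card (B t)" by blast
  then show ?thesis using card_bag_le[OF TB(1), of t] TB(2) by simp
qed

section \<open>Row-treewidth of graphs with a universal vertex\<close>

lemma subgraph_up_to_iso_embedding:
  assumes "subgraph_up_to_iso G X"
  obtains f where "inj_on f (pverts G)" "f ` pverts G \<subseteq> pverts X"
    "\<And>u v. (u, v) \<in> parcs G \<Longrightarrow> (f u, f v) \<in> parcs X"
proof -
  obtain S where S: "subgraph (with_proj S) (with_proj X)" "digraph_iso (with_proj G) (with_proj S)"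
    using assms by (auto simp: subgraph_up_to_iso_def)
  then obtain h where h: "pre_digraph.digraph_isomorphism (with_proj G) h"
    and Sh: "with_proj S = app_iso h (with_proj G)"
    by (auto simp: digraph_iso_def)
  note isoD = h[unfolded pre_digraph.digraph_isomorphism_def, simplified]
  from Sh have "verts (with_proj S) = verts (app_iso h (with_proj G))"
    "arcs (with_proj S) = arcs (app_iso h (with_proj G))"
    "tail (with_proj S) = tail (app_iso h (with_proj G))"
    "head (with_proj S) = head (app_iso h (with_proj G))" by simp_all
  then have S': "pverts S = iso_verts h ` pverts G" "parcs S = iso_arcs h ` parcs G"
    "iso_tail h = fst" "iso_head h = snd" by simp_all
  show ?thesis
  proof (rule that[of "iso_verts h"])
    show "inj_on (iso_verts h) (pverts G)" using isoD by blast
    show "iso_verts h ` pverts G \<subseteq> pverts X" using S(1) S'(1) by (auto simp: subgraph_def)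
    show "(iso_verts h u, iso_verts h v) \<in> parcs X" if "(u, v) \<in> parcs G" for u v
    proof -
      have "iso_verts h u = fst (iso_arcs h (u, v))" "iso_verts h v = snd (iso_arcs h (u, v))"
        using isoD that S' by force+
      then have "iso_arcs h (u, v) = (iso_verts h u, iso_verts h v)" by simp
      moreover have "iso_arcs h (u, v) \<in> parcs S" using S'(2) that by simp
      ultimately show ?thesis using S(1) by (auto simp: subgraph_def)
    qed
  qed
qed

text \<open>
  Some product contains \<open>G\<close>, so the minimum that defines \<^const>\<open>row_treewidth\<close> is attained.
\<close>

lemma subgraph_of_trivial_strong_product:
  assumes "pair_graph G"
  shows "subgraph_up_to_iso G (G \<boxtimes> path_graph 0)"
proof -
  interpret pair_graph G by fact
  define S where "S = \<lparr>pverts = (\<lambda>v. (v, 0 :: nat)) ` pverts G,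
    parcs = (\<lambda>(u, v). ((u, 0), (v, 0))) ` parcs G\<rparr>"
  have "pair_wf_digraph (G \<boxtimes> path_graph 0)"
    by unfold_locales (auto simp: strong_product_def)
  moreover have "pair_wf_digraph S"
    by unfold_locales (auto simp: S_def dest: in_arcsD1 in_arcsD2)
  moreover have "pverts S \<subseteq> pverts (G \<boxtimes> path_graph 0)" "parcs S \<subseteq> parcs (G \<boxtimes> path_graph 0)"
    by (auto simp: S_def strong_product_def path_graph_def dest: in_arcsD1 in_arcsD2 no_loops')
  ultimately have "subgraph (with_proj S) (with_proj (G \<boxtimes> path_graph 0))"
    by (auto simp: subgraph_def wf_digraph_wp_iff)
  moreover have "digraph_iso (with_proj G) (with_proj S)"
    unfolding digraph_iso_def
  proof (intro exI conjI)
    let ?h = "\<lparr>iso_verts = (\<lambda>v. (v, 0)), iso_arcs = (\<lambda>(u, v). ((u, 0 :: nat), (v, 0))),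
      iso_head = snd, iso_tail = fst\<rparr>"
    show "digraph_isomorphism ?h"
      by (auto simp: digraph_isomorphism_def inj_on_def wf_digraph)
    show "with_proj S = app_iso ?h (with_proj G)"
      by (simp add: app_iso_def with_proj_def S_def)
  qed
  ultimately show ?thesis by (auto simp: subgraph_up_to_iso_def)
qed

text \<open>
  All other vertices are adjacent to \<open>z\<close> and so lie in its row or in one of the two rows next to it.
  Replacing each vertex of \<open>H\<close> in the bags by its at most three copies in \<open>G\<close> yields a tree
  decomposition of \<open>G\<close> whose bags are at most three times as large.
\<close>

theorem treewidth_le_row_treewidth:
  fixes G :: "nat sgraph"
  assumes G: "pair_graph G" and z: "z \<in> pverts G"
    and univ: "\<And>v. v \<in> pverts G \<Longrightarrow> v \<noteq> z \<Longrightarrow> (z, v) \<in> parcs G"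
  shows "treewidth G \<le> 3 * row_treewidth G + 2"
proof -
  interpret pair_graph G by fact
  have "\<exists>t (H :: nat sgraph) m. pair_graph H \<and> treewidth H = t \<and>
      subgraph_up_to_iso G (H \<boxtimes> path_graph m)"
    using G subgraph_of_trivial_strong_product[OF G] by blast
  then have "\<exists>(H :: nat sgraph) m. pair_graph H \<and> treewidth H = row_treewidth G \<and>
      subgraph_up_to_iso G (H \<boxtimes> path_graph m)"
    unfolding row_treewidth_def by (rule LeastI_ex)
  then obtain H :: "nat sgraph" and m where H: "pair_graph H" "treewidth H = row_treewidth G"
    and emb: "subgraph_up_to_iso G (H \<boxtimes> path_graph m)" by blast
  interpret H: pair_graph H by fact
  obtain f where inj: "inj_on f (pverts G)" and into: "f ` pverts G \<subseteq> pverts (H \<boxtimes> path_graph m)"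
    and arc: "\<And>u v. (u, v) \<in> parcs G \<Longrightarrow> (f u, f v) \<in> parcs (H \<boxtimes> path_graph m)"
    using subgraph_up_to_iso_embedding[OF emb] by metis
  have fH: "fst (f v) \<in> pverts H" if "v \<in> pverts G" for v
    using into that by (force simp: strong_product_def)
  have arcH: "fst (f u) = fst (f v) \<or> (fst (f u), fst (f v)) \<in> parcs H" if "(u, v) \<in> parcs G" for u v
    using arc[OF that] by (auto simp: strong_product_def)
  define q where "q = snd (f z)"
  have rows: "snd (f v) \<in> {q - 1, q, q + 1}" if "v \<in> pverts G" for v
  proof (cases "v = z")
    case False
    then have "(f z, f v) \<in> parcs (H \<boxtimes> path_graph m)" using arc univ that by blast
    then show ?thesis by (auto simp: strong_product_def path_graph_def q_def)
  qed (simp add: q_def)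
  obtain T :: "nat sgraph" and B where
    TB: "tree_decomposition H T B" "decomposition_width T B = treewidth H"
    using obtain_optimal_tree_decomposition[OF H(1)] by metis
  have T: "undirected_tree T" "pair_graph T"
    using TB by (auto simp: tree_decomposition_def undirected_tree_def)
  have B: "(\<Union>t \<in> pverts T. B t) = pverts H"
    "\<And>x y. (x, y) \<in> parcs H \<Longrightarrow> \<exists>t \<in> pverts T. x \<in> B t \<and> y \<in> B t"
    "\<And>x. x \<in> pverts H \<Longrightarrow> Digraph_Component.connected (with_proj T \<restriction> {t \<in> pverts T. x \<in> B t})"
    using TB by (auto simp: tree_decomposition_def)
  define B' where "B' t = {v \<in> pverts G. fst (f v) \<in> B t}" for t
  have "tree_decomposition G T B'"
    unfolding tree_decomposition_def
  proof (intro conjI ballI T)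
    show "(\<Union>t \<in> pverts T. B' t) = pverts G" using fH B(1) by (fastforce simp: B'_def)
    show "case e of (u, v) \<Rightarrow> \<exists>t \<in> pverts T. u \<in> B' t \<and> v \<in> B' t" if "e \<in> parcs G" for e
    proof (cases e)
      case (Pair u v)
      then have uv: "u \<in> pverts G" "v \<in> pverts G" using that in_arcsD1 in_arcsD2 by auto
      have "\<exists>t \<in> pverts T. fst (f u) \<in> B t \<and> fst (f v) \<in> B t"
        using arcH[of u v] that Pair fH[OF uv(1)] B(1,2) by (metis UN_iff)
      then show ?thesis using uv Pair by (auto simp: B'_def)
    qed
    show "Digraph_Component.connected (with_proj T \<restriction> {t \<in> pverts T. v \<in> B' t})"
      if "v \<in> pverts G" for v
      using B(3)[OF fH[OF that]] that by (simp add: B'_def)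
  qed
  then have "treewidth G \<le> decomposition_width T B'" by (rule treewidth_le_decomposition_width)
  also have "\<dots> \<le> 3 * row_treewidth G + 2"
  proof (rule decomposition_width_leI[OF T(1)])
    fix t assume t: "t \<in> pverts T"
    have "B t \<subseteq> pverts H" using B(1) t by blast
    then have fin: "finite (B t)" using H.pair_finite_verts finite_subset by blast
    have "f v \<in> B t \<times> {q - 1, q, q + 1}" if "v \<in> B' t" for v
      using rows[of v] that unfolding B'_def mem_Times_iff by blast
    then have "f ` B' t \<subseteq> B t \<times> {q - 1, q, q + 1}" by blast
    then have "card (B' t) \<le> card (B t \<times> {q - 1, q, q + 1})"
      using inj fin by (intro card_inj_on_le[of f]) (auto simp: B'_def inj_on_def)
    also have "\<dots> \<le> card (B t) * 3"
      by (simp add: card_cartesian_product card_insert_if)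
    also have "card (B t) \<le> row_treewidth G + 1" using card_bag_le[OF TB(1) t] TB(2) H(2) by simp
    finally show "card (B' t) \<le> 3 * row_treewidth G + 2 + 1" by simp
  qed
  finally show ?thesis .
qed

section \<open>Clique number\<close>

lemma clique_number_leI:
  assumes "finite (pverts G)"
    and "\<And>K. K \<subseteq> pverts G \<Longrightarrow> (\<And>u v. u \<in> K \<Longrightarrow> v \<in> K \<Longrightarrow> u \<noteq> v \<Longrightarrow> (u, v) \<in> parcs G) \<Longrightarrow> card K \<le> b"
    and "pair_graph G"
  shows "clique_number G \<le> b"
proof -
  interpret pair_graph G by fact
  let ?M = "{k. \<exists>K. subgraph (with_proj K) (with_proj G) \<and> complete_digraph k (with_proj K)}"
  have le: "k \<le> b" if "k \<in> ?M" for k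
  proof -
    from that obtain K where sub: "subgraph (with_proj K) (with_proj G)"
      and K: "card (pverts K) = k" "parcs K = {(u, v). (u, v) \<in> pverts K \<times> pverts K \<and> u \<noteq> v}"
      by (auto simp: complete_digraph_pair_def)
    have "pverts K \<subseteq> pverts G" "parcs K \<subseteq> parcs G" using sub by (auto simp: subgraph_def)
    then have "card (pverts K) \<le> b" using K(2) by (intro assms(2)) auto
    then show ?thesis using K(1) by simp
  qed
  have "subgraph (with_proj \<lparr>pverts = {}, parcs = {}\<rparr>) (with_proj G)"
    by (auto simp: subgraph_def wf_digraph_wp_iff pair_wf_digraph pair_wf_digraph_def)
  then have "0 \<in> ?M"
    by (intro CollectI exI[of _ "\<lparr>pverts = {}, parcs = {}\<rparr>"]) (simp add: complete_digraph_pair_def)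
  moreover have "finite ?M" by (rule finite_subset[of _ "{..b}"]) (use le in auto)
  ultimately show ?thesis unfolding clique_number_def using le by (intro Max.boundedI) auto
qed

section \<open>Adjacency in polar coordinates\<close>

lemma hyp_dist_polar_le_iff:
  fixes a b \<phi> \<psi> d :: real
  assumes "a \<ge> 0" "b \<ge> 0" "d \<ge> 0"
  shows "hyp_dist (complex_of_real (tanh (a / 2)) * cis \<phi>) (complex_of_real (tanh (b / 2)) * cis \<psi>) \<le> d
    \<longleftrightarrow> cosh (a - b) + 2 * sinh a * sinh b * (sin ((\<phi> - \<psi>) / 2))\<^sup>2 \<le> cosh d" (is "?D \<le> d \<longleftrightarrow> ?Y \<le> _")
proof -
  have "cos (\<phi> - \<psi>) = 1 - 2 * (sin ((\<phi> - \<psi>) / 2))\<^sup>2"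
    using cos_double_sin[of "(\<phi> - \<psi>) / 2"] by (simp only: mult_2 field_sum_of_halves)
  then have "cosh a * cosh b - sinh a * sinh b * cos (\<phi> - \<psi>) = ?Y"
    by (simp only: cosh_diff) (simp add: right_diff_distrib)
  then have "?D = arcosh ?Y" by (simp add: hyp_dist_polar)
  moreover have "sinh a \<ge> 0" "sinh b \<ge> 0" using assms by simp_all
  then have "?Y \<ge> 1" using cosh_real_ge_1[of "a - b"] by (smt (verit) mult_nonneg_nonneg zero_le_power2)
  then have "arcosh ?Y \<le> arcosh (cosh d) \<longleftrightarrow> ?Y \<le> cosh d"
    by (meson arcosh_less_iff_real cosh_real_ge_1 linorder_not_less)
  ultimately show ?thesis using assms by (simp add: arcosh_cosh_real)
qed

lemma half_le_sin:
  fixes x :: real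
  assumes "0 \<le> x" "x \<le> 1"
  shows "x / 2 \<le> sin x"
proof -
  have "\<bar>sin x - (\<Sum>m<3. sin_coeff m * x ^ m)\<bar> \<le> inverse (fact 3) * \<bar>x\<bar> ^ 3"
    by (rule Maclaurin_sin_bound)
  moreover have "(\<Sum>m<3. sin_coeff m * x ^ m) = x"
    by (simp add: numeral_3_eq_3 sin_coeff_def)
  moreover have "x ^ 3 \<le> x" using assms power_decreasing[of 1 3 x] by simp
  ultimately have "\<bar>sin x - x\<bar> \<le> x / 6" using assms by (simp add: fact_numeral)
  then show ?thesis using assms by linarith
qed

text \<open>
  The term \<open>2 * sinh a * sinh b * sin\<^sup>2 (\<delta> / 2)\<close> of the law of cosines is at most
  \<open>exp (2 * \<rho>) * 2\<^bsup>l+m\<^esup> * \<delta>\<^sup>2 / 8\<close>, while \<open>cosh (a - b)\<close> is only of order \<open>exp \<rho>\<close>, and their sum must not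
  exceed \<open>cosh (2 * \<rho>) \<ge> exp (2 * \<rho>) / 2\<close>.
\<close>

lemma disk_adjacency_sufficient:
  fixes \<rho> \<phi> \<psi> :: real and l m :: nat
  assumes \<rho>: "\<rho> \<ge> 2" and lm: "real l * ln 2 \<le> \<rho>" "real m * ln 2 \<le> \<rho>"
    and near: "(\<phi> - \<psi>)\<^sup>2 * 2 ^ (l + m) \<le> 1"
  shows "hyp_dist (complex_of_real (tanh ((\<rho> + real l * ln 2) / 2)) * cis \<phi>)
    (complex_of_real (tanh ((\<rho> + real m * ln 2) / 2)) * cis \<psi>) \<le> 2 * \<rho>"
proof -
  define a b where "a = \<rho> + real l * ln 2" and "b = \<rho> + real m * ln 2"
  have "real l * ln 2 \<ge> 0" "real m * ln 2 \<ge> 0" by simp_all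
  then have ab: "a \<ge> 0" "b \<ge> 0" "\<bar>a - b\<bar> \<le> \<rho>" unfolding a_def b_def using \<rho> lm by linarith+
  have ea: "exp a = exp \<rho> * 2 ^ l" and eb: "exp b = exp \<rho> * 2 ^ m"
    by (simp_all add: a_def b_def exp_add exp_of_nat_mult)
  have sh: "sinh a \<le> exp a / 2" "sinh b \<le> exp b / 2" "sinh a \<ge> 0" "sinh b \<ge> 0"
    using ab by (simp_all add: sinh_field_def)
  have "(sin ((\<phi> - \<psi>) / 2))\<^sup>2 \<le> ((\<phi> - \<psi>) / 2)\<^sup>2"
    using abs_sin_x_le_abs_x[of "(\<phi> - \<psi>) / 2"] by (simp only: abs_le_square_iff)
  moreover have "sinh a * sinh b \<le> exp a / 2 * (exp b / 2)"
    using sh by (intro mult_mono) auto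
  ultimately have "sinh a * sinh b * (sin ((\<phi> - \<psi>) / 2))\<^sup>2
      \<le> exp a / 2 * (exp b / 2) * ((\<phi> - \<psi>) / 2)\<^sup>2"
    using sh by (intro mult_mono) auto
  also have "\<dots> = (exp \<rho>)\<^sup>2 / 16 * ((\<phi> - \<psi>)\<^sup>2 * 2 ^ (l + m))"
    unfolding ea eb by (simp add: power2_eq_square power_add field_simps)
  also have "\<dots> \<le> (exp \<rho>)\<^sup>2 / 16" using near by (intro mult_left_le) auto
  finally have 1: "2 * sinh a * sinh b * (sin ((\<phi> - \<psi>) / 2))\<^sup>2 \<le> (exp \<rho>)\<^sup>2 / 8" by simp
  have "cosh (a - b) \<le> cosh \<rho>" using ab \<rho> cosh_real_abs[of "a - b"]
    by (metis abs_ge_zero cosh_real_nonneg_le_iff order_trans)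
  also have "\<dots> \<le> exp \<rho>" using \<rho> by (simp add: cosh_field_def)
  also have "\<dots> \<le> (exp \<rho>)\<^sup>2 / 3"
  proof -
    have "exp \<rho> \<ge> 3" using exp_ge_add_one_self[of \<rho>] \<rho> by linarith
    then have "3 * exp \<rho> \<le> exp \<rho> * exp \<rho>" by (intro mult_right_mono) auto
    then show ?thesis by (simp add: power2_eq_square)
  qed
  finally have 2: "cosh (a - b) \<le> (exp \<rho>)\<^sup>2 / 3" .
  have "cosh (2 * \<rho>) \<ge> (exp \<rho>)\<^sup>2 / 2" by (simp add: cosh_field_def exp_double)
  then have "cosh (a - b) + 2 * sinh a * sinh b * (sin ((\<phi> - \<psi>) / 2))\<^sup>2 \<le> cosh (2 * \<rho>)"
    using 1 2 zero_le_power2[of "exp \<rho>"] by linarith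
  then show ?thesis
    using hyp_dist_polar_le_iff[of a b "2 * \<rho>" \<phi> \<psi>] ab \<rho> by (simp add: a_def b_def)
qed

text \<open>
  The converse estimate, at the price of the constant: it uses \<open>sinh x \<ge> exp x / 4\<close> for the radii and
  \<open>sin x \<ge> x / 2\<close> for half the angle difference.
\<close>

lemma disk_adjacency_necessary:
  fixes \<rho> \<phi> \<psi> :: real and l m :: nat
  assumes \<rho>: "\<rho> \<ge> 2" and small: "\<bar>\<phi> - \<psi>\<bar> \<le> 1"
    and adj: "hyp_dist (complex_of_real (tanh ((\<rho> + real l * ln 2) / 2)) * cis \<phi>)
      (complex_of_real (tanh ((\<rho> + real m * ln 2) / 2)) * cis \<psi>) \<le> 2 * \<rho>"
  shows "(\<phi> - \<psi>)\<^sup>2 * 2 ^ (l + m) \<le> 128"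
proof -
  define a b where "a = \<rho> + real l * ln 2" and "b = \<rho> + real m * ln 2"
  have ab: "a \<ge> 2" "b \<ge> 2" using \<rho> by (auto simp: a_def b_def intro: add_increasing2)
  have ea: "exp a = exp \<rho> * 2 ^ l" and eb: "exp b = exp \<rho> * 2 ^ m"
    by (simp_all add: a_def b_def exp_add exp_of_nat_mult)
  have sh: "sinh x \<ge> exp x / 4" if "x \<ge> 2" for x :: real
  proof -
    have "exp x \<ge> 2" using exp_ge_add_one_self[of x] that by linarith
    moreover have "exp (- x) \<le> 1" using that by simp
    ultimately have "exp (- x) \<le> exp x / 2" by linarith
    then show ?thesis by (simp add: sinh_field_def)
  qed
  have "cosh (a - b) + 2 * sinh a * sinh b * (sin ((\<phi> - \<psi>) / 2))\<^sup>2 \<le> cosh (2 * \<rho>)"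
    using hyp_dist_polar_le_iff[of a b "2 * \<rho>" \<phi> \<psi>] ab \<rho> adj by (simp add: a_def b_def)
  moreover have "cosh (2 * \<rho>) \<le> (exp \<rho>)\<^sup>2"
  proof -
    have "exp (- (2 * \<rho>)) \<le> exp (2 * \<rho>)" using \<rho> by simp
    then show ?thesis by (simp add: cosh_field_def flip: exp_double)
  qed
  ultimately have "2 * sinh a * sinh b * (sin ((\<phi> - \<psi>) / 2))\<^sup>2 \<le> (exp \<rho>)\<^sup>2"
    using cosh_real_ge_1[of "a - b"] by linarith
  moreover have "exp a / 4 * (exp b / 4) * ((\<phi> - \<psi>) / 4)\<^sup>2 \<le> sinh a * sinh b * (sin ((\<phi> - \<psi>) / 2))\<^sup>2"
  proof (intro mult_mono)
    define x where "x = (\<phi> - \<psi>) / 2"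
    have "\<bar>x\<bar> / 2 \<le> sin \<bar>x\<bar>" using half_le_sin[of "\<bar>x\<bar>"] small by (simp add: x_def)
    then have "(\<bar>x\<bar> / 2)\<^sup>2 \<le> (sin \<bar>x\<bar>)\<^sup>2" by (intro power_mono) auto
    moreover have "(sin \<bar>x\<bar>)\<^sup>2 = (sin x)\<^sup>2" by (cases "x \<ge> 0") (simp_all add: abs_if)
    ultimately show "((\<phi> - \<psi>) / 4)\<^sup>2 \<le> (sin ((\<phi> - \<psi>) / 2))\<^sup>2"
      by (simp add: x_def power_divide)
  qed (use sh ab in auto)
  ultimately have "exp a / 4 * (exp b / 4) * ((\<phi> - \<psi>) / 4)\<^sup>2 \<le> (exp \<rho>)\<^sup>2 / 2" by linarith
  moreover have "exp a / 4 * (exp b / 4) * ((\<phi> - \<psi>) / 4)\<^sup>2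
      = (exp \<rho>)\<^sup>2 / 2 * ((\<phi> - \<psi>)\<^sup>2 * 2 ^ (l + m) / 128)"
    unfolding ea eb by (simp add: power2_eq_square power_add field_simps)
  ultimately have "(\<phi> - \<psi>)\<^sup>2 * 2 ^ (l + m) / 128 \<le> 1"
    by (metis exp_gt_zero half_gt_zero mult.right_neutral mult_le_cancel_left_pos zero_less_power)
  then show ?thesis by simp
qed

section \<open>The ring graphs\<close>

text \<open>
  Vertices are numbered like a binary heap with root 1: the ring of level \<open>l\<close> consists of
  \<open>2\<^sup>l, \<dots>, 2\<^bsup>l+1\<^esup> - 1\<close>, so the level of \<open>v\<close> is \<open>floor_log v\<close>. The \<open>j\<close>-th vertex of the ring
  has angle \<open>1 + (2 * j + 1) / 2\<^bsup>l+1\<^esup>\<close>, the middle of the \<open>j\<close>-th of \<open>2\<^sup>l\<close> equal parts of the interval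
  from 1 to 2. Vertex 0 is the origin.
\<close>

definition heap_angle :: "nat \<Rightarrow> real" where
  "heap_angle v = (2 * real v + 1) / 2 ^ Suc (floor_log v)"

definition heap_point :: "real \<Rightarrow> nat \<Rightarrow> complex" where
  "heap_point \<rho> v = (if v = 0 then 0 else
     complex_of_real (tanh ((\<rho> + real (floor_log v) * ln 2) / 2)) * cis (heap_angle v))"

definition ring :: "nat \<Rightarrow> nat set" where
  "ring l = {2 ^ l..<2 ^ Suc l}"

definition ring_verts :: "nat set \<Rightarrow> nat set" where
  "ring_verts L = {0} \<union> (\<Union>l \<in> L. ring l)"

definition ring_graph :: "real \<Rightarrow> nat set \<Rightarrow> nat sgraph" where
  "ring_graph \<rho> L = \<lparr>pverts = ring_verts L,
     parcs = {(u, v). u \<in> ring_verts L \<and> v \<in> ring_verts L \<and> u \<noteq> v \<and>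
       hyp_dist (heap_point \<rho> u) (heap_point \<rho> v) \<le> 2 * \<rho>}\<rparr>"

lemma ring_iff: "v \<in> ring l \<longleftrightarrow> v > 0 \<and> floor_log v = l"
proof
  assume v: "v \<in> ring l"
  moreover from v have "v > 0" by (metis ring_def atLeastLessThan_iff gr0I not_less power_eq_0_iff zero_le zero_neq_numeral le_zero_eq)
  ultimately show "v > 0 \<and> floor_log v = l" by (auto simp: ring_def intro!: floor_log_eqI)
next
  assume "v > 0 \<and> floor_log v = l"
  then show "v \<in> ring l" using floor_log_exp2_le[of v] floor_log_exp2_gt[of v] by (auto simp: ring_def)
qed

lemma ring_verts_iff: "v \<in> ring_verts L \<longleftrightarrow> floor_log v \<in> L" if "v > 0" for v
  using that by (auto simp: ring_verts_def ring_iff)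

lemma finite_ring_verts: "finite L \<Longrightarrow> finite (ring_verts L)"
  by (auto simp: ring_verts_def ring_def)

lemma hyp_dist_commute: "hyp_dist z w = hyp_dist w z"
  by (simp add: hyp_dist_def norm_minus_commute mult.commute)

lemma pverts_ring_graph [simp]: "pverts (ring_graph \<rho> L) = ring_verts L"
  by (simp add: ring_graph_def)

lemma pair_graph_ring_graph:
  assumes "finite L"
  shows "pair_graph (ring_graph \<rho> L)"
proof -
  have "finite (parcs (ring_graph \<rho> L))"
    by (rule finite_subset[of _ "ring_verts L \<times> ring_verts L"])
      (auto simp: ring_graph_def finite_ring_verts assms)
  then show ?thesis
    by unfold_locales
      (auto simp: ring_graph_def finite_ring_verts assms symmetric_def sym_def hyp_dist_commute)
qed

lemma heap_angle_bounds:
  assumes "v > 0"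
  shows "1 < heap_angle v" "heap_angle v < 2"
proof -
  have "v \<in> ring (floor_log v)" using assms by (simp add: ring_iff)
  moreover define p :: nat where "p = 2 ^ floor_log v"
  ultimately have "p \<le> v" "Suc v \<le> 2 * p" by (auto simp: ring_def)
  then have "real p \<le> real v" "real v + 1 \<le> 2 * real p" by linarith+
  moreover have "p > 0" "heap_angle v = (2 * real v + 1) / (2 * real p)"
    by (simp_all add: p_def heap_angle_def)
  ultimately show "1 < heap_angle v" "heap_angle v < 2"
    by (simp_all add: less_divide_eq divide_less_eq)
qed

section \<open>Separation of angles\<close>

lemma heap_angle_scaled:
  assumes "floor_log v \<le> M"
  shows "heap_angle v * 2 ^ Suc M = real ((2 * v + 1) * 2 ^ (M - floor_log v))"
proof -
  have "(2 :: real) ^ Suc M = 2 ^ Suc (floor_log v) * 2 ^ (M - floor_log v)"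
    using assms by (simp flip: power_add)
  then have "heap_angle v * 2 ^ Suc M = (heap_angle v * 2 ^ Suc (floor_log v)) * 2 ^ (M - floor_log v)"
    by (simp only: mult.assoc)
  also have "heap_angle v * 2 ^ Suc (floor_log v) = real (2 * v + 1)"
    by (simp add: heap_angle_def)
  finally show ?thesis by (simp only: of_nat_mult of_nat_power of_nat_numeral)
qed

text \<open>
  In units of \<open>2\<^bsup>-M-1\<^esup>\<close> the angles of the vertices up to level \<open>M\<close> are integers, and the level is
  determined by the exact power of two dividing the integer.
\<close>

lemma heap_angle_scaled_inj:
  assumes "u > 0" "v > 0" "u \<noteq> v" "floor_log u \<le> M" "floor_log v \<le> M"
  shows "(2 * u + 1) * 2 ^ (M - floor_log u) \<noteq> (2 * v + 1) * 2 ^ (M - floor_log v)"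
proof
  assume eq: "(2 * u + 1) * 2 ^ (M - floor_log u) = (2 * v + 1) * 2 ^ (M - floor_log v)"
  \<comment> \<open>otherwise the left-hand side has at least one more factor 2 than the right-hand side\<close>
  have *: "floor_log a \<ge> floor_log b"
    if "(2 * a + 1) * 2 ^ (M - floor_log a) = (2 * b + 1) * 2 ^ (M - floor_log b)"
      "floor_log a \<le> M" "floor_log b \<le> M" for a b
  proof (rule ccontr)
    assume "\<not> floor_log a \<ge> floor_log b"
    then have "M - floor_log a = Suc (M - Suc (floor_log a))"
      "M - floor_log b \<le> M - Suc (floor_log a)" using that by auto
    then have "2 * 2 ^ (M - floor_log b) dvd (2 * b + 1) * (2 :: nat) ^ (M - floor_log b)"
      by (metis dvd_mult le_imp_power_dvd power_Suc mult_dvd_mono dvd_refl that(1))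
    then have "2 dvd 2 * b + 1" 
      using dvd_times_right_cancel_iff[of "2 ^ (M - floor_log b)" 2 "2 * b + 1"] by simp
    then show False by simp
  qed
  have "floor_log u = floor_log v" using *[OF eq] *[OF eq[symmetric]] assms by force
  with eq assms(3) show False by simp
qed

lemma heap_angle_separated:
  assumes "u > 0" "v > 0" "u \<noteq> v" "floor_log u \<le> M" "floor_log v \<le> M"
  shows "1 \<le> (heap_angle u - heap_angle v)\<^sup>2 * (2 ^ Suc M)\<^sup>2"
proof -
  define U V where "U = (2 * u + 1) * 2 ^ (M - floor_log u)" and "V = (2 * v + 1) * 2 ^ (M - floor_log v)"
  have "U \<noteq> V" using heap_angle_scaled_inj[OF assms] by (simp add: U_def V_def)
  then have "1 \<le> \<bar>int U - int V\<bar>" by simp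
  then have "1 \<le> \<bar>real U - real V\<bar>" by linarith
  then have "1 \<le> (real U - real V)\<^sup>2" using abs_le_square_iff[of 1 "real U - real V"] by simp
  also have "real U - real V = (heap_angle u - heap_angle v) * 2 ^ Suc M"
    using heap_angle_scaled assms by (simp add: U_def V_def left_diff_distrib)
  finally show ?thesis by (simp add: power_mult_distrib)
qed

text \<open>
  The squared distance of \<open>u\<close> and \<open>v\<close> is at most \<open>2\<^sup>9 * 2\<^bsup>-l-M\<^esup>\<close> by closeness to \<open>x\<close> and at least
  \<open>2\<^bsup>-2m-2\<^esup>\<close> by separation, where \<open>l\<close> and \<open>m\<close> are their levels; comparing exponents gives
  \<open>l + M \<le> 2 * m + 11\<close>.
\<close>

lemma close_pair_levels:
  assumes u: "(heap_angle u - x)\<^sup>2 * 2 ^ (floor_log u + M) \<le> 128"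
    and v: "(heap_angle v - x)\<^sup>2 * 2 ^ (floor_log v + M) \<le> 128"
    and uv: "u > 0" "v > 0" "u \<noteq> v" "floor_log u \<le> floor_log v" "floor_log v \<le> M"
  shows "2 * (M - floor_log v) \<le> (M - floor_log u) + 11"
proof -
  define l m D where "l = floor_log u" and "m = floor_log v" and "D = heap_angle u - heap_angle v"
  have "(heap_angle v - x)\<^sup>2 * 2 ^ (l + M) \<le> (heap_angle v - x)\<^sup>2 * 2 ^ (m + M)"
    using uv by (intro mult_left_mono power_increasing) (auto simp: l_def m_def)
  then have 1: "(heap_angle v - x)\<^sup>2 * 2 ^ (l + M) \<le> 128" using v by (simp add: m_def)
  have "D\<^sup>2 \<le> 2 * (heap_angle u - x)\<^sup>2 + 2 * (heap_angle v - x)\<^sup>2"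
    using zero_le_power2[of "heap_angle u - x + (heap_angle v - x)"]
    by (simp add: D_def power2_eq_square algebra_simps)
  then have "D\<^sup>2 * 2 ^ (l + M) \<le> (2 * (heap_angle u - x)\<^sup>2 + 2 * (heap_angle v - x)\<^sup>2) * 2 ^ (l + M)"
    by (intro mult_right_mono) auto
  also have "\<dots> \<le> 512" using 1 u by (simp add: l_def distrib_right)
  finally have 2: "D\<^sup>2 * 2 ^ (l + M) \<le> 512" .
  have 3: "1 \<le> D\<^sup>2 * (2 ^ Suc m)\<^sup>2" using heap_angle_separated[OF uv(1-3), of m] uv
    by (simp add: D_def m_def)
  have "(2 :: real) ^ (l + M) \<le> (D\<^sup>2 * (2 ^ Suc m)\<^sup>2) * 2 ^ (l + M)"
    using mult_right_mono[OF 3, of "2 ^ (l + M)"] by simp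
  also have "\<dots> = (2 ^ Suc m)\<^sup>2 * (D\<^sup>2 * 2 ^ (l + M))" by (simp add: mult_ac)
  also have "\<dots> \<le> (2 ^ Suc m)\<^sup>2 * 512" using 2 by (intro mult_left_mono) auto
  also have "\<dots> = 2 ^ (2 * m + 11)" by (simp add: power_add power_mult power2_eq_square flip: power_mult_distrib)
  finally have "l + M \<le> 2 * m + 11" by (subst (asm) power_increasing_iff) auto
  then show ?thesis using uv by (simp add: l_def m_def)
qed

text \<open>
  Vertices whose depth below level \<open>M\<close> is at most 11 lie within 1024 units of \<open>2\<^bsup>-M-1\<^esup>\<close> around \<open>w\<close>
  and have different integer positions.
\<close>

lemma card_close_points_le:
  assumes N: "\<And>v. v \<in> N \<Longrightarrow> v > 0 \<and> floor_log v \<le> M \<and> M \<le> floor_log v + 11 \<and>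
      (heap_angle v - heap_angle w)\<^sup>2 * 2 ^ (floor_log v + M) \<le> 128"
    and w: "floor_log w = M"
  shows "card N \<le> 2049"
proof -
  define X where "X v = int ((2 * v + 1) * 2 ^ (M - floor_log v))" for v
  have "inj_on X N"
    using N heap_angle_scaled_inj[of _ _ M] unfolding inj_on_def X_def by (metis of_nat_eq_iff)
  moreover have "X ` N \<subseteq> {X w - 1024..X w + 1024}"
  proof (rule image_subsetI)
    fix v assume "v \<in> N"
    note v = N[OF this]
    define D where "D = heap_angle v - heap_angle w"
    have "real_of_int (X v - X w) = D * 2 ^ Suc M"
      using heap_angle_scaled[of v M] heap_angle_scaled[of w M] v w
      by (simp add: X_def D_def left_diff_distrib)
    then have "(real_of_int (X v - X w))\<^sup>2 = D\<^sup>2 * 2 ^ (2 * M + 2)"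
      by (simp add: power_mult_distrib power_add power_mult power2_eq_square flip: power_mult_distrib)
    also have "2 * M + 2 = (floor_log v + M) + (M - floor_log v + 2)" using v by simp
    also have "D\<^sup>2 * 2 ^ \<dots> = (D\<^sup>2 * 2 ^ (floor_log v + M)) * 2 ^ (M - floor_log v + 2)"
      by (simp only: power_add mult.assoc)
    also have "\<dots> \<le> 128 * 2 ^ 13"
      using v by (intro mult_mono power_increasing) (auto simp: D_def)
    also have "\<dots> = (1024 :: real)\<^sup>2" by simp
    finally have "\<bar>real_of_int (X v - X w)\<bar> \<le> 1024"
      by (simp only: abs_le_square_iff[symmetric])
    then show "X v \<in> {X w - 1024..X w + 1024}" by auto
  qed
  ultimately have "card N \<le> card {X w - 1024..X w + 1024}" by (intro card_inj_on_le) auto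
  then show ?thesis by simp
qed

section \<open>The rings form a clique minor\<close>

context
  fixes \<rho> :: real and L :: "nat set"
  assumes finite_L: "finite L" and \<rho>: "\<rho> \<ge> 2" and levels: "\<And>l. l \<in> L \<Longrightarrow> real l * ln 2 \<le> \<rho>"
begin

lemma level_of_vert: "v \<in> ring_verts L \<Longrightarrow> v > 0 \<Longrightarrow> floor_log v \<in> L"
  by (simp add: ring_verts_iff)

lemma hyp_dist_origin:
  assumes "v \<in> ring_verts L"
  shows "hyp_dist 0 (heap_point \<rho> v) \<le> 2 * \<rho>"
proof (cases "v = 0")
  case True
  then show ?thesis using \<rho> by (simp add: heap_point_def hyp_dist_def)
next
  case False
  define a where "a = \<rho> + real (floor_log v) * ln 2"
  have "floor_log v \<in> L" using False assms level_of_vert by auto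
  then have a: "0 \<le> a" "a \<le> 2 * \<rho>" using levels \<rho> by (auto simp: a_def)
  have "hyp_dist 0 (heap_point \<rho> v) = arcosh (cosh a)"
    using hyp_dist_polar[of 0 0 a "heap_angle v"] False by (simp add: heap_point_def a_def)
  then show ?thesis using a by (simp add: arcosh_cosh_real)
qed

lemma shudg_ring_graph: "shudg \<rho> (ring_graph \<rho> L)"
  unfolding shudg_def
proof (intro conjI pair_graph_ring_graph finite_L exI[of _ "heap_point \<rho>"] ballI impI)
  have "\<bar>tanh x\<bar> < 1" for x :: real
    using tanh_real_lt_1[of x] tanh_real_gt_neg1[of x] by linarith
  then show "heap_point \<rho> ` pverts (ring_graph \<rho> L) \<subseteq> hyp_plane"
    by (auto simp: heap_point_def hyp_plane_def norm_mult)
  show "hyp_dist 0 (heap_point \<rho> v) \<le> 2 * \<rho>" if "v \<in> pverts (ring_graph \<rho> L)" for v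
    using that hyp_dist_origin by simp
  show "(u, v) \<in> parcs (ring_graph \<rho> L) \<longleftrightarrow> hyp_dist (heap_point \<rho> u) (heap_point \<rho> v) \<le> 2 * \<rho>"
    if "u \<in> pverts (ring_graph \<rho> L)" "v \<in> pverts (ring_graph \<rho> L)" "u \<noteq> v" for u v
    using that by (simp add: ring_graph_def)
qed (use \<rho> in simp)

lemma origin_universal:
  assumes "v \<in> ring_verts L" "v \<noteq> 0"
  shows "(0, v) \<in> parcs (ring_graph \<rho> L)"
proof -
  have "heap_point \<rho> 0 = 0" "0 \<in> ring_verts L" by (simp_all add: heap_point_def ring_verts_def)
  then show ?thesis using assms hyp_dist_origin[of v] by (simp add: ring_graph_def)
qed

lemma near_imp_adjacent:
  assumes uv: "u \<in> ring_verts L" "v \<in> ring_verts L" "u \<noteq> v" "u > 0" "v > 0"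
    and near: "(heap_angle u - heap_angle v)\<^sup>2 * 2 ^ (floor_log u + floor_log v) \<le> 1"
  shows "(u, v) \<in> parcs (ring_graph \<rho> L)"
proof -
  have "hyp_dist (heap_point \<rho> u) (heap_point \<rho> v) \<le> 2 * \<rho>"
    using disk_adjacency_sufficient[OF \<rho> levels levels near] uv level_of_vert
    by (simp add: heap_point_def)
  then show ?thesis using uv by (simp add: ring_graph_def)
qed

lemma adjacent_imp_near:
  assumes "(u, v) \<in> parcs (ring_graph \<rho> L)" "u > 0" "v > 0"
  shows "(heap_angle u - heap_angle v)\<^sup>2 * 2 ^ (floor_log u + floor_log v) \<le> 128"
proof (rule disk_adjacency_necessary[OF \<rho>])
  show "\<bar>heap_angle u - heap_angle v\<bar> \<le> 1"
    using heap_angle_bounds[OF assms(2)] heap_angle_bounds[OF assms(3)] by auto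
qed (use assms in \<open>simp add: ring_graph_def heap_point_def\<close>)

lemma ring_subset: "l \<in> L \<Longrightarrow> ring l \<subseteq> ring_verts L"
  by (auto simp: ring_verts_def)

lemma ring_connected:
  assumes "l \<in> L"
  shows "connected_in (parcs (ring_graph \<rho> L)) (ring l)"
proof -
  interpret pair_graph "ring_graph \<rho> L" by (rule pair_graph_ring_graph[OF finite_L])
  let ?R = "rtrancl_on (ring l) (parcs (ring_graph \<rho> L))"
  have sym: "sym ?R"
    by (rule rtrancl_on_sym) (auto intro: symI arcs_symmetric)
  have step: "(v, Suc v) \<in> parcs (ring_graph \<rho> L)" if "v \<in> ring l" "Suc v \<in> ring l" for v
  proof (rule near_imp_adjacent)
    have lev: "floor_log v = l" "floor_log (Suc v) = l" using that by (auto simp: ring_iff)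
    \<comment> \<open>with this spacing the sufficient condition for adjacency holds with equality\<close>
    have "heap_angle v - heap_angle (Suc v) = - (1 / 2 ^ l)"
      by (simp add: heap_angle_def lev field_simps)
    then show "(heap_angle v - heap_angle (Suc v))\<^sup>2 * 2 ^ (floor_log v + floor_log (Suc v)) \<le> 1"
      by (simp add: lev power_divide power_add power2_eq_square)
  qed (use that ring_subset[OF assms] in \<open>auto simp: ring_iff\<close>)
  have from_left: "(2 ^ l, v) \<in> ?R" if "2 ^ l \<le> v" "v \<in> ring l" for v
    using that
  proof (induction v rule: dec_induct)
    case base
    then show ?case by simp
  next
    case (step v)
    then have "v \<in> ring l" by (auto simp: ring_def)
    with step show ?case using \<open>\<And>v. v \<in> ring l \<Longrightarrow> Suc v \<in> ring l \<Longrightarrow> (v, Suc v) \<in> _\<close>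
      by (blast intro: rtrancl_on_into_rtrancl_on)
  qed
  have "(u, v) \<in> ?R" if "u \<in> ring l" "v \<in> ring l" for u v
  proof -
    have "2 ^ l \<le> u" "2 ^ l \<le> v" using that by (auto simp: ring_def)
    then show ?thesis using from_left that symD[OF sym] by (blast intro: rtrancl_on_trans)
  qed
  moreover have "ring l \<noteq> {}" by (simp add: ring_def)
  ultimately show ?thesis by (simp add: connected_in_def)
qed

text \<open>
  Around a vertex of level \<open>l\<close>, the nearest vertices of level \<open>m\<close> are at angular distance
  \<open>2\<^bsup>-m-1\<^esup>\<close>; the proof takes the leftmost vertex of ring \<open>l\<close>.
\<close>

lemma rings_adjacent:
  assumes "l \<in> L" "m \<in> L" "l < m"
  shows "\<exists>u \<in> ring l. \<exists>v \<in> ring m. (u, v) \<in> parcs (ring_graph \<rho> L)"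
proof -
  define u v :: nat where "u = 2 ^ l" and "v = 2 ^ m + 2 ^ (m - l - 1)"
  have u: "u \<in> ring l" by (simp add: u_def ring_def)
  have "(2 :: nat) ^ (m - l - 1) < 2 ^ m" using assms by (intro power_strict_increasing) auto
  then have v: "v \<in> ring m" by (simp add: v_def ring_def)
  have lev: "floor_log u = l" "floor_log v = m" "u > 0" "v > 0" using u v by (auto simp: ring_iff)
  have m: "(2 :: real) ^ m = 2 * 2 ^ l * 2 ^ (m - l - 1)"
    using assms by (simp add: power_add[symmetric] flip: power_Suc)
  have "heap_angle u - heap_angle v = - (1 / (2 * 2 ^ m))"
    unfolding heap_angle_def lev by (simp add: u_def v_def m field_simps)
  then have "(heap_angle u - heap_angle v)\<^sup>2 * 2 ^ (l + m) = (1 / (2 * 2 ^ m))\<^sup>2 * 2 ^ (l + m)"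
    by simp
  also have "\<dots> = (2 ^ l / 2 ^ m) / 4"
    by (simp add: power_add power2_eq_square)
  also have "\<dots> \<le> 1"
  proof -
    have "(2 :: real) ^ l / 2 ^ m \<le> 1"
      using power_increasing[of l m "2 :: real"] assms by (subst divide_le_eq_1) auto
    moreover have "x / 4 \<le> 1" if "x \<le> 1" for x :: real using that by simp
    ultimately show ?thesis by blast
  qed
  finally have "(u, v) \<in> parcs (ring_graph \<rho> L)"
    using u v lev ring_subset assms by (intro near_imp_adjacent) auto
  then show ?thesis using u v by blast
qed

text \<open>
  The rings are disjoint, connected and pairwise adjacent.
\<close>

theorem treewidth_ring_graph: "card L \<le> treewidth (ring_graph \<rho> L) + 1"
proof (rule treewidth_ge_clique_minor[OF pair_graph_ring_graph[OF finite_L] finite_L])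
  interpret pair_graph "ring_graph \<rho> L" by (rule pair_graph_ring_graph[OF finite_L])
  show "\<exists>u \<in> ring l. \<exists>v \<in> ring m. (u, v) \<in> parcs (ring_graph \<rho> L)"
    if "l \<in> L" "m \<in> L" "l \<noteq> m" for l m
    using rings_adjacent[of l m] rings_adjacent[of m l] that arcs_symmetric
    by (metis linorder_neq_iff)
qed (use ring_connected ring_subset in \<open>auto simp: ring_iff\<close>)

theorem row_treewidth_ring_graph: "card L \<le> 3 * row_treewidth (ring_graph \<rho> L) + 3"
proof -
  have "treewidth (ring_graph \<rho> L) \<le> 3 * row_treewidth (ring_graph \<rho> L) + 2"
    by (rule treewidth_le_row_treewidth[OF pair_graph_ring_graph[OF finite_L], of 0])
      (simp_all add: origin_universal ring_verts_def)
  then show ?thesis using treewidth_ring_graph by linarith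
qed

section \<open>Cliques of ring graphs\<close>

text \<open>
  Here \<open>M\<close> is the largest level in the clique. The constant counts the origin and the at most 2049
  vertices with level at least \<open>M - 11\<close>. For the others the halving inequality excludes two vertices of
  the same level, since \<open>2 * d \<le> d + 11\<close> fails for \<open>d \<ge> 12\<close>; so they are counted by the set \<open>F\<close> of
  their levels.
\<close>

lemma clique_card_le:
  assumes K: "K \<subseteq> ring_verts L"
    and clique: "\<And>u v. u \<in> K \<Longrightarrow> v \<in> K \<Longrightarrow> u \<noteq> v \<Longrightarrow> (u, v) \<in> parcs (ring_graph \<rho> L)"
  obtains M F where "F \<subseteq> L" "F = {} \<or> M \<in> L" "\<And>l. l \<in> F \<Longrightarrow> l + 12 \<le> M"
    "\<And>l m. l \<in> F \<Longrightarrow> m \<in> F \<Longrightarrow> l < m \<Longrightarrow> 2 * (M - m) \<le> (M - l) + 11" "card K \<le> card F + 2050"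
proof (cases "K \<subseteq> {0}")
  case True
  then have "card K \<le> 1" using card_mono[of "{0}" K] by simp
  then show ?thesis using that[of "{}" 0] by simp
next
  case False
  have fin: "finite K" using K finite_ring_verts[OF finite_L] finite_subset by blast
  define K' where "K' = K - {0}"
  have "K' \<noteq> {}" "finite K'" using False fin by (auto simp: K'_def)
  then have "Max (floor_log ` K') \<in> floor_log ` K'" by (intro Max_in) auto
  then obtain w where w: "w \<in> K'" and "Max (floor_log ` K') = floor_log w" by blast
  then have max: "floor_log v \<le> floor_log w" if "v \<in> K'" for v
    using that \<open>finite K'\<close> by (metis Max_ge finite_imageI imageI)
  define M where "M = floor_log w"
  have near: "(heap_angle v - heap_angle w)\<^sup>2 * 2 ^ (floor_log v + M) \<le> 128" if "v \<in> K'" for v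
    using adjacent_imp_near[of v w] clique[of v w] that w by (cases "v = w") (auto simp: K'_def M_def)
  define R N where "R = {v \<in> K'. floor_log v + 12 \<le> M}" and "N = {v \<in> K'. M \<le> floor_log v + 11}"
  have spread: "2 * (M - floor_log v) \<le> (M - floor_log u) + 11"
    if "u \<in> K'" "v \<in> K'" "u \<noteq> v" "floor_log u \<le> floor_log v" for u v
    using close_pair_levels[OF near near] that max by (auto simp: K'_def M_def)
  have inj: "inj_on floor_log R"
  proof (rule inj_onI, rule ccontr)
    fix u v assume "u \<in> R" "v \<in> R" "floor_log u = floor_log v" "u \<noteq> v"
    then show False using spread[of u v] by (auto simp: R_def)
  qed
  have N: "card N \<le> 2049"
    by (rule card_close_points_le[of N M w]) (use near max in \<open>auto simp: N_def K'_def M_def\<close>)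
  have "K \<subseteq> insert 0 (N \<union> R)" by (auto simp: N_def R_def K'_def)
  then have "card K \<le> card (insert 0 (N \<union> R))"
    using fin by (intro card_mono) (auto simp: N_def R_def K'_def)
  also have "\<dots> \<le> Suc (card (N \<union> R))" by (rule card_insert_le_m1) auto
  also have "card (N \<union> R) \<le> card N + card R" by (rule card_Un_le)
  finally have card: "card K \<le> card (floor_log ` R) + 2050" using N by (simp add: card_image[OF inj])
  show ?thesis
  proof (rule that[of "floor_log ` R" M, OF _ _ _ _ card])
    show "floor_log ` R \<subseteq> L" using K level_of_vert by (auto simp: R_def K'_def)
    show "floor_log ` R = {} \<or> M \<in> L" using K w level_of_vert by (auto simp: K'_def M_def)
    show "2 * (M - m) \<le> (M - l) + 11" if "l \<in> floor_log ` R" "m \<in> floor_log ` R" "l < m" for l m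
      using that spread by (fastforce simp: R_def)
  qed (auto simp: R_def)
qed

lemma clique_number_ring_graph_le:
  assumes "\<And>M F. F \<subseteq> L \<Longrightarrow> F = {} \<or> M \<in> L \<Longrightarrow> (\<And>l. l \<in> F \<Longrightarrow> l + 12 \<le> M) \<Longrightarrow>
      (\<And>l m. l \<in> F \<Longrightarrow> m \<in> F \<Longrightarrow> l < m \<Longrightarrow> 2 * (M - m) \<le> (M - l) + 11) \<Longrightarrow> card F \<le> b"
  shows "clique_number (ring_graph \<rho> L) \<le> b + 2050"
proof (rule clique_number_leI)
  fix K assume K: "K \<subseteq> pverts (ring_graph \<rho> L)"
    and clique: "\<And>u v. u \<in> K \<Longrightarrow> v \<in> K \<Longrightarrow> u \<noteq> v \<Longrightarrow> (u, v) \<in> parcs (ring_graph \<rho> L)"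
  show "card K \<le> b + 2050"
  proof (rule clique_card_le[OF K[simplified] clique])
    fix M F
    assume "F \<subseteq> L" "F = {} \<or> M \<in> L" "\<And>l. l \<in> F \<Longrightarrow> l + 12 \<le> M"
      "\<And>l m. l \<in> F \<Longrightarrow> m \<in> F \<Longrightarrow> l < m \<Longrightarrow> 2 * (M - m) \<le> (M - l) + 11"
      "card K \<le> card F + 2050"
    moreover from this have "card F \<le> b" by (intro assms) auto
    ultimately show ?thesis by linarith
  qed
qed (simp_all add: finite_ring_verts finite_L pair_graph_ring_graph)

end

text \<open>
  After subtracting 11 the depths \<open>M - l\<close> are positive and halve from one to the next, so they have
  different binary logarithms.
\<close>

lemma card_halving_le:
  fixes F :: "nat set"
  assumes M: "\<And>l. l \<in> F \<Longrightarrow> l + 12 \<le> M"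
    and halving: "\<And>l m. l \<in> F \<Longrightarrow> m \<in> F \<Longrightarrow> l < m \<Longrightarrow> 2 * (M - m) \<le> (M - l) + 11"
  shows "card F \<le> floor_log M + 1"
proof -
  define e where "e l = floor_log (M - l - 11)" for l
  have less: "e m < e l" if "l \<in> F" "m \<in> F" "l < m" for l m
  proof -
    have "2 * (M - m - 11) \<le> M - l - 11" "M - m - 11 \<noteq> 0" using halving[OF that] M that by fastforce+
    then have "floor_log (2 * (M - m - 11)) \<le> e l" unfolding e_def by (intro floor_log_le_iff)
    then show ?thesis using \<open>M - m - 11 \<noteq> 0\<close> by (simp add: e_def)
  qed
  have "inj_on e F" using less by (metis inj_onI less_irrefl linorder_neq_iff)
  moreover have "e ` F \<subseteq> {..floor_log M}" by (auto simp: e_def intro: floor_log_le_iff)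
  ultimately have "card F \<le> card {..floor_log M}" by (intro card_inj_on_le) auto
  then show ?thesis by simp
qed

text \<open>
  All members of \<open>F\<close> are at most \<open>M / 4\<close>, so their depths are between \<open>3 * M / 4\<close> and \<open>M\<close> and cannot
  halve unless \<open>M\<close> is small.
\<close>

lemma card_sparse_halving_le:
  fixes F :: "nat set"
  assumes F: "F \<subseteq> range (\<lambda>i. 4 ^ i)" and M: "M = 4 ^ k"
    and far: "\<And>l. l \<in> F \<Longrightarrow> l + 12 \<le> M"
    and halving: "\<And>l m. l \<in> F \<Longrightarrow> m \<in> F \<Longrightarrow> l < m \<Longrightarrow> 2 * (M - m) \<le> (M - l) + 11"
  shows "card F \<le> 11"
proof (cases "M \<le> 22")
  case True
  then have "F \<subseteq> {..10}" using far by fastforce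
  then show ?thesis using card_mono[of "{..10}" F] by simp
next
  case False
  have quarter: "4 * m \<le> M" if m: "m \<in> F" for m
  proof -
    obtain i where i: "m = 4 ^ i" using F m by auto
    have "(4 :: nat) ^ i < 4 ^ k" using far[OF m] unfolding i M by linarith
    then have "Suc i \<le> k" by (subst (asm) power_strict_increasing_iff) auto
    then have "(4 :: nat) ^ Suc i \<le> 4 ^ k" by (intro power_increasing) auto
    then show ?thesis by (simp add: i M)
  qed
  have "l = m" if "l \<in> F" "m \<in> F" for l m
    using halving[of l m] halving[of m l] quarter[of l] quarter[of m] False that by linarith
  then have "\<exists>x. F \<subseteq> {x}" by blast
  then obtain x where "F \<subseteq> {x}" ..
  then show ?thesis using card_mono[of "{x}" F] by simp
qed

section \<open>Families of ring graphs\<close>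

text \<open>
  The deepest ring has \<open>2\<^sup>h\<close> vertices, and all heap numbers up to level \<open>h\<close> are below
  \<open>2\<^bsup>h+1\<^esup>\<close>.
\<close>

lemma card_ring_verts:
  assumes L: "finite L" "h \<in> L" "\<And>l. l \<in> L \<Longrightarrow> l \<le> h"
  shows "2 ^ h \<le> card (ring_verts L)" "card (ring_verts L) \<le> 2 ^ Suc h"
proof -
  have "card (ring h) \<le> card (ring_verts L)"
    using L by (intro card_mono finite_ring_verts) (auto simp: ring_verts_def)
  then show "2 ^ h \<le> card (ring_verts L)" by (simp add: ring_def)
  have "ring_verts L \<subseteq> {..<2 ^ Suc h}"
  proof
    fix v assume "v \<in> ring_verts L"
    then consider "v = 0" | l where "l \<in> L" "v < 2 ^ Suc l" by (auto simp: ring_verts_def ring_def)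
    then show "v \<in> {..<2 ^ Suc h}"
    proof cases
      case 2
      have "(2 :: nat) ^ Suc l \<le> 2 ^ Suc h" using L(3)[OF 2(1)] by (intro power_increasing) auto
      from less_le_trans[OF 2(2) this] show ?thesis by simp
    qed simp
  qed
  then have "card (ring_verts L) \<le> card {..<2 ^ Suc h :: nat}" by (intro card_mono) auto
  then show "card (ring_verts L) \<le> 2 ^ Suc h" by simp
qed

lemma filterlim_order_of: "filterlim order_of at_top (large_in \<G>)"
  unfolding filterlim_at_top eventually_large_in by blast

text \<open>
  Asymptotics over a family reduce to asymptotics of sequences once the parameter of each member is
  bounded by a function of its order.
\<close>

lemma bigo_family:
  fixes f :: "'a sgraph \<Rightarrow> real" and g h :: "nat \<Rightarrow> real"
  assumes "\<And>G. G \<in> \<G> \<Longrightarrow> \<bar>f G\<bar> \<le> g (order_of G)" and "g \<in> O(h)"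
  shows "f \<in> O[large_in \<G>](\<lambda>G. h (order_of G))"
proof -
  have "f \<in> O[large_in \<G>](\<lambda>G. g (order_of G))"
    using assms(1) by (intro bigoI[of _ 1]) (fastforce simp: eventually_large_in)
  also have "(\<lambda>G. g (order_of G)) \<in> O[large_in \<G>](\<lambda>G. h (order_of G))"
    by (rule landau_o.big.compose[OF assms(2) filterlim_order_of])
  finally show ?thesis .
qed

lemma bigomega_family:
  fixes f :: "'a sgraph \<Rightarrow> real" and g h :: "nat \<Rightarrow> real"
  assumes "\<And>G. G \<in> \<G> \<Longrightarrow> g (order_of G) \<le> f G" and "eventually (\<lambda>n. g n \<ge> 0) at_top" and "g \<in> \<Omega>(h)"
  shows "f \<in> \<Omega>[large_in \<G>](\<lambda>G. h (order_of G))"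
proof -
  obtain N where N: "\<And>n. n \<ge> N \<Longrightarrow> g n \<ge> 0" using assms(2) by (auto simp: eventually_at_top_linorder)
  have "\<forall>G \<in> \<G>. order_of G \<ge> N \<longrightarrow> norm (f G) \<ge> 1 * norm (g (order_of G))"
    using N assms(1) by force
  then have "f \<in> \<Omega>[large_in \<G>](\<lambda>G. g (order_of G))"
    by (intro landau_omega.bigI[of 1]) (auto simp: eventually_large_in)
  also have "(\<lambda>G. g (order_of G)) \<in> \<Omega>[large_in \<G>](\<lambda>G. h (order_of G))"
    by (rule landau_omega.big.compose[OF assms(3) filterlim_order_of])
  finally show ?thesis .
qed

text \<open>
  The summand \<open>ln n + 2\<close> makes the radius admissible for all levels in \<open>L\<close>; under
  \<open>r \<in> \<Omega>(\<lambda>n. ln n)\<close> it does not change the order of growth.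
\<close>

definition family_radius :: "(nat \<Rightarrow> real) \<Rightarrow> nat set \<Rightarrow> real" where
  "family_radius r L = r (card (ring_verts L)) + ln (real (card (ring_verts L))) + 2"

definition ring_family :: "(nat \<Rightarrow> real) \<Rightarrow> (nat \<Rightarrow> nat set) \<Rightarrow> nat sgraph set" where
  "ring_family r L = range (\<lambda>k. ring_graph (family_radius r (L k)) (L k))"

context
  fixes r :: "nat \<Rightarrow> real" and L :: "nat \<Rightarrow> nat set" and depth :: "nat \<Rightarrow> nat"
  assumes r: "\<And>n. r n > 0" "r \<in> \<Omega>(\<lambda>n. ln (real n))"
    and L: "\<And>k. finite (L k)" "\<And>k. depth k \<in> L k" "\<And>k l. l \<in> L k \<Longrightarrow> l \<le> depth k" "\<And>k. k \<le> depth k"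
begin

lemma log_card_bounds:
  "real (depth k) \<le> log 2 (real (card (ring_verts (L k))))"
  "log 2 (real (card (ring_verts (L k)))) \<le> real (depth k) + 1"
proof -
  define n where "n = card (ring_verts (L k))"
  have "2 ^ depth k \<le> n" "n \<le> 2 ^ Suc (depth k)"
    using card_ring_verts[OF L(1) L(2) L(3), of k] by (auto simp: n_def)
  moreover from this have "n > 0" by (metis gr0I le_zero_eq power_not_zero zero_neq_numeral)
  ultimately show "real (depth k) \<le> log 2 (real n)" "log 2 (real n) \<le> real (depth k) + 1"
    using le_log2_of_power[of "depth k" n] log2_of_power_le[of n "Suc (depth k)"] by auto
qed

lemma family_radius_bounds:
  "family_radius r (L k) \<ge> 2" "l \<in> L k \<Longrightarrow> real l * ln 2 \<le> family_radius r (L k)"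
proof -
  define n where "n = card (ring_verts (L k))"
  have top: "real (depth k) * ln 2 \<le> ln (real n)"
    using log_card_bounds(1)[of k] by (simp add: log_def pos_le_divide_eq flip: n_def)
  moreover have "real (depth k) * ln 2 \<ge> 0" by simp
  ultimately show "family_radius r (L k) \<ge> 2"
    using r(1)[of n] unfolding family_radius_def n_def[symmetric] by linarith
  show "real l * ln 2 \<le> family_radius r (L k)" if "l \<in> L k"
  proof -
    have "real l * ln 2 \<le> real (depth k) * ln 2" using L(3)[OF that] by (intro mult_right_mono) auto
    then show ?thesis
      using top r(1)[of n] unfolding family_radius_def n_def[symmetric] by linarith
  qed
qed

lemmas ring_graph_facts = L(1) family_radius_bounds

lemma shudg_family_ring_family: "shudg_family (ring_family r L)"
  unfolding shudg_family_def
proof (intro conjI allI ballI)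
  show "\<exists>\<rho>. shudg \<rho> G" if "G \<in> ring_family r L" for G
    using that shudg_ring_graph[OF ring_graph_facts] by (auto simp: ring_family_def)
  show "\<exists>G \<in> ring_family r L. N \<le> order_of G" for N
  proof -
    have "N \<le> depth N" by (rule L(4))
    also have "\<dots> \<le> 2 ^ depth N" by (rule less_imp_le[OF less_exp])
    also have "\<dots> \<le> card (ring_verts (L N))" by (rule card_ring_verts(1)[OF L(1-3)])
    finally show ?thesis by (auto simp: ring_family_def)
  qed
qed

lemma disk_radius_ring_family: "disk_radius_Theta (ring_family r L) r"
proof -
  obtain c where c: "c > 0" and ev: "\<forall>\<^sub>F n in at_top. norm (r n) \<ge> c * norm (ln (real n))"
    using r(2) by (rule landau_omega.bigE)
  from ev obtain N where N: "\<And>n. n \<ge> N \<Longrightarrow> c * \<bar>ln (real n)\<bar> \<le> \<bar>r n\<bar>"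
    by (auto simp: eventually_at_top_linorder)
  have "\<forall>\<^sub>F G in large_in (ring_family r L). \<exists>\<rho>. shudg \<rho> G \<and>
      1 * r (order_of G) \<le> \<rho> \<and> \<rho> \<le> (1 + 3 / c) * r (order_of G)"
    unfolding eventually_large_in
  proof (rule exI[of _ "max N 3"], intro ballI impI)
    fix G assume "G \<in> ring_family r L" and big: "max N 3 \<le> order_of G"
    then obtain k where G: "G = ring_graph (family_radius r (L k)) (L k)" by (auto simp: ring_family_def)
    define n where "n = card (ring_verts (L k))"
    have n: "n \<ge> N" "n \<ge> 3" using big by (simp_all add: G n_def)
    \<comment> \<open>so \<open>ln n + 2 \<le> 3 * ln n\<close>, whence the constant \<open>1 + 3 / c\<close>\<close>
    have ln: "ln (real n) \<ge> 1" using n exp_le by (subst ln_ge_iff) auto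
    have "c * ln (real n) \<le> r n" using N[OF n(1)] ln r(1)[of n] by simp
    then have "ln (real n) \<le> r n / c" using c by (simp add: pos_le_divide_eq mult.commute)
    then have "family_radius r (L k) \<le> (1 + 3 / c) * r n" "r n \<le> family_radius r (L k)"
      using ln by (auto simp: family_radius_def distrib_right simp flip: n_def)
    moreover have "shudg (family_radius r (L k)) G"
      unfolding G by (rule shudg_ring_graph[OF ring_graph_facts])
    ultimately show "\<exists>\<rho>. shudg \<rho> G \<and> 1 * r (order_of G) \<le> \<rho> \<and> \<rho> \<le> (1 + 3 / c) * r (order_of G)"
      by (auto simp: G n_def)
  qed
  moreover have "1 + 3 / c > 0" using c by (simp add: add_pos_pos)
  ultimately show ?thesis unfolding disk_radius_Theta_def using zero_less_one by blast
qed

end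

theorem corollary21:
  fixes r :: "nat \<Rightarrow> real"
  assumes "\<And>n. r n > 0"
    and "r \<in> \<Omega>(\<lambda>n. ln (real n))"
  shows
    "(\<exists>\<G> :: nat sgraph set.
        shudg_family \<G> \<and> disk_radius_Theta \<G> r \<and>
        (\<lambda>G. real (clique_number G)) \<in> O[large_in \<G>](\<lambda>G. ln (ln (real (order_of G)))) \<and>
        (\<lambda>G. real (treewidth G)) \<in> \<Omega>[large_in \<G>](\<lambda>G. ln (real (order_of G))) \<and>
        (\<lambda>G. real (row_treewidth G)) \<in> \<Omega>[large_in \<G>](\<lambda>G. ln (real (order_of G)))) \<and>
     (\<exists>\<G> :: nat sgraph set.
        shudg_family \<G> \<and> disk_radius_Theta \<G> r \<and>
        (\<lambda>G. real (clique_number G)) \<in> O[large_in \<G>](\<lambda>_. 1) \<and>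
        (\<lambda>G. real (treewidth G)) \<in> \<Omega>[large_in \<G>](\<lambda>G. ln (ln (real (order_of G)))) \<and>
        (\<lambda>G. real (row_treewidth G)) \<in> \<Omega>[large_in \<G>](\<lambda>G. ln (ln (real (order_of G)))))"
proof (intro conjI)
  let ?L = "\<lambda>k. {..k}" and ?depth = "\<lambda>k :: nat. k"
  let ?G = "\<lambda>k. ring_graph (family_radius r (?L k)) (?L k)"
  have L: "finite (?L k)" "?depth k \<in> ?L k" "l \<in> ?L k \<Longrightarrow> l \<le> ?depth k" "k \<le> ?depth k" for k l :: nat
    by simp_all
  note facts = ring_graph_facts[of r ?L ?depth, OF assms L]
  note log = log_card_bounds[of r ?L ?depth, OF assms L]
  let ?F = "ring_family r ?L"
  have "shudg_family ?F" by (rule shudg_family_ring_family[of r ?L ?depth, OF assms L])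
  moreover have "disk_radius_Theta ?F r" by (rule disk_radius_ring_family[of r ?L ?depth, OF assms L])
  moreover have "(\<lambda>G. real (clique_number G)) \<in> O[large_in ?F](\<lambda>G. ln (ln (real (order_of G))))"
  proof (rule bigo_family[where g = "\<lambda>n. log 2 (log 2 (real n) + 1) + 2051" and h = "\<lambda>n. ln (ln (real n))"])
    fix G assume "G \<in> ?F"
    then obtain k where G: "G = ?G k" by (auto simp: ring_family_def)
    have "clique_number G \<le> (floor_log k + 1) + 2050"
      unfolding G
    proof (rule clique_number_ring_graph_le[OF facts])
      fix M and F :: "nat set"
      assume M: "F = {} \<or> M \<in> {..k}" and F: "\<And>l. l \<in> F \<Longrightarrow> l + 12 \<le> M"
        "\<And>l m. l \<in> F \<Longrightarrow> m \<in> F \<Longrightarrow> l < m \<Longrightarrow> 2 * (M - m) \<le> (M - l) + 11"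
      have "card F \<le> floor_log M + 1" by (rule card_halving_le[OF F])
      then show "card F \<le> floor_log k + 1" using M floor_log_le_iff[of M k] by auto
    qed
    then have "real (clique_number G) \<le> real (floor_log k) + 2051" by linarith
    also have "real (floor_log k) \<le> log 2 (real k + 1)"
    proof -
      have "2 ^ floor_log k \<le> k + 1" using floor_log_exp2_le[of k] by (cases "k = 0") auto
      then show ?thesis using le_log2_of_power[of "floor_log k" "k + 1"] by (simp add: add.commute)
    qed
    also have "\<dots> \<le> log 2 (log 2 (real (order_of G)) + 1)" using log(1)[of k] by (simp add: G)
    finally show "\<bar>real (clique_number G)\<bar> \<le> log 2 (log 2 (real (order_of G)) + 1) + 2051" by simp
  next
    show "(\<lambda>n :: nat. log 2 (log 2 (real n) + 1) + 2051) \<in> O(\<lambda>n. ln (ln (real n)))" by real_asymp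
  qed
  moreover have "(\<lambda>G. real (treewidth G)) \<in> \<Omega>[large_in ?F](\<lambda>G. ln (real (order_of G)))"
  proof (rule bigomega_family[where g = "\<lambda>n. log 2 (real n) - 1"])
    fix G assume "G \<in> ?F"
    then obtain k where G: "G = ?G k" by (auto simp: ring_family_def)
    have "k \<le> treewidth G" using treewidth_ring_graph[OF facts, of k] by (simp add: G)
    then show "log 2 (real (order_of G)) - 1 \<le> real (treewidth G)" using log(2)[of k] by (simp add: G)
  next
    show "\<forall>\<^sub>F n in at_top. log 2 (real n) - 1 \<ge> 0" by real_asymp
    show "(\<lambda>n :: nat. log 2 (real n) - 1) \<in> \<Omega>(\<lambda>n. ln (real n))" by real_asymp
  qed
  moreover have "(\<lambda>G. real (row_treewidth G)) \<in> \<Omega>[large_in ?F](\<lambda>G. ln (real (order_of G)))"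
  proof (rule bigomega_family[where g = "\<lambda>n. (log 2 (real n) - 3) / 3"])
    fix G assume "G \<in> ?F"
    then obtain k where G: "G = ?G k" by (auto simp: ring_family_def)
    have "k \<le> 3 * row_treewidth G + 2" using row_treewidth_ring_graph[OF facts, of k] by (simp add: G)
    then show "(log 2 (real (order_of G)) - 3) / 3 \<le> real (row_treewidth G)" using log(2)[of k] by (simp add: G)
  next
    show "\<forall>\<^sub>F n in at_top. (log 2 (real n) - 3) / 3 \<ge> 0" by real_asymp
    show "(\<lambda>n :: nat. (log 2 (real n) - 3) / 3) \<in> \<Omega>(\<lambda>n. ln (real n))" by real_asymp
  qed
  ultimately show "\<exists>\<G> :: nat sgraph set.
        shudg_family \<G> \<and> disk_radius_Theta \<G> r \<and>
        (\<lambda>G. real (clique_number G)) \<in> O[large_in \<G>](\<lambda>G. ln (ln (real (order_of G)))) \<and>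
        (\<lambda>G. real (treewidth G)) \<in> \<Omega>[large_in \<G>](\<lambda>G. ln (real (order_of G))) \<and>
        (\<lambda>G. real (row_treewidth G)) \<in> \<Omega>[large_in \<G>](\<lambda>G. ln (real (order_of G)))"
    by blast
next
  let ?L = "\<lambda>k. (\<lambda>i. (4 :: nat) ^ i) ` {..k}" and ?depth = "\<lambda>k :: nat. 4 ^ k :: nat"
  let ?G = "\<lambda>k. ring_graph (family_radius r (?L k)) (?L k)"
  have L: "finite (?L k)" "?depth k \<in> ?L k" "l \<in> ?L k \<Longrightarrow> l \<le> ?depth k" "k \<le> ?depth k" for k l :: nat
    by (auto intro: power_increasing less_imp_le[OF power_gt_expt])
  note facts = ring_graph_facts[of r ?L ?depth, OF assms L]
  note log = log_card_bounds[of r ?L ?depth, OF assms L]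
  have card_L: "card (?L k) = Suc k" for k by (subst card_image) (auto simp: inj_on_def)
  have loglog: "log 4 (log 2 (real (order_of (?G k)))) \<le> real k + 1" for k
  proof -
    define n where "n = order_of (?G k)"
    have "(4 :: real) ^ k \<ge> 1" by simp
    moreover have "4 ^ k \<le> log 2 (real n)" "log 2 (real n) \<le> 4 ^ k + 1"
      using log[of k] by (simp_all add: n_def)
    ultimately have n: "log 2 (real n) \<ge> 1" "log 2 (real n) \<le> 4 ^ k + 1" by linarith+
    have "log 2 (real n) \<le> 4 ^ Suc k"
      using n(2) \<open>(4 :: real) ^ k \<ge> 1\<close> unfolding power_Suc by linarith
    then have "log 4 (log 2 (real n)) \<le> log 4 (4 ^ Suc k)" using n(1) by (subst log_le_cancel_iff) auto
    also have "\<dots> = real (Suc k)" by (rule log_pow_cancel) auto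
    finally show ?thesis by (simp add: n_def)
  qed
  let ?F = "ring_family r ?L"
  have "shudg_family ?F" by (rule shudg_family_ring_family[of r ?L ?depth, OF assms L])
  moreover have "disk_radius_Theta ?F r" by (rule disk_radius_ring_family[of r ?L ?depth, OF assms L])
  moreover have "(\<lambda>G. real (clique_number G)) \<in> O[large_in ?F](\<lambda>_. 1)"
  proof (rule bigo_family[where g = "\<lambda>_. 2061"])
    fix G assume "G \<in> ?F"
    then obtain k where G: "G = ?G k" by (auto simp: ring_family_def)
    have "clique_number G \<le> 11 + 2050"
      unfolding G
    proof (rule clique_number_ring_graph_le[OF facts])
      fix M and F :: "nat set"
      assume sub: "F \<subseteq> ?L k" and M: "F = {} \<or> M \<in> ?L k" and F: "\<And>l. l \<in> F \<Longrightarrow> l + 12 \<le> M"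
        "\<And>l m. l \<in> F \<Longrightarrow> m \<in> F \<Longrightarrow> l < m \<Longrightarrow> 2 * (M - m) \<le> (M - l) + 11"
      show "card F \<le> 11"
      proof (cases "F = {}")
        case False
        then obtain j where "M = 4 ^ j" using M by blast
        moreover have "F \<subseteq> range (\<lambda>i. 4 ^ i)" using sub by blast
        ultimately show ?thesis by (intro card_sparse_halving_le[OF _ _ F])
      qed simp
    qed
    then show "\<bar>real (clique_number G)\<bar> \<le> 2061" by simp
  next
    show "(\<lambda>n :: nat. 2061 :: real) \<in> O(\<lambda>_. 1)" by simp
  qed
  moreover have "(\<lambda>G. real (treewidth G)) \<in> \<Omega>[large_in ?F](\<lambda>G. ln (ln (real (order_of G))))"
  proof (rule bigomega_family[where g = "\<lambda>n. log 4 (log 2 (real n)) - 1"])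
    fix G assume "G \<in> ?F"
    then obtain k where G: "G = ?G k" by (auto simp: ring_family_def)
    have "k \<le> treewidth G" using treewidth_ring_graph[OF facts, of k] by (simp add: G card_L)
    then show "log 4 (log 2 (real (order_of G))) - 1 \<le> real (treewidth G)" using loglog[of k] by (simp add: G)
  next
    show "\<forall>\<^sub>F n in at_top. log 4 (log 2 (real n)) - 1 \<ge> 0" by real_asymp
    show "(\<lambda>n :: nat. log 4 (log 2 (real n)) - 1) \<in> \<Omega>(\<lambda>n. ln (ln (real n)))" by real_asymp
  qed
  moreover have "(\<lambda>G. real (row_treewidth G)) \<in> \<Omega>[large_in ?F](\<lambda>G. ln (ln (real (order_of G))))"
  proof (rule bigomega_family[where g = "\<lambda>n. (log 4 (log 2 (real n)) - 3) / 3"])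
    fix G assume "G \<in> ?F"
    then obtain k where G: "G = ?G k" by (auto simp: ring_family_def)
    have "k \<le> 3 * row_treewidth G + 2"
      using row_treewidth_ring_graph[OF facts, of k] by (simp add: G card_L)
    then show "(log 4 (log 2 (real (order_of G))) - 3) / 3 \<le> real (row_treewidth G)"
      using loglog[of k] by (simp add: G)
  next
    show "\<forall>\<^sub>F n in at_top. (log 4 (log 2 (real n)) - 3) / 3 \<ge> 0" by real_asymp
    show "(\<lambda>n :: nat. (log 4 (log 2 (real n)) - 3) / 3) \<in> \<Omega>(\<lambda>n. ln (ln (real n)))" by real_asymp
  qed
  ultimately show "\<exists>\<G> :: nat sgraph set.
        shudg_family \<G> \<and> disk_radius_Theta \<G> r \<and>
        (\<lambda>G. real (clique_number G)) \<in> O[large_in \<G>](\<lambda>_. 1) \<and>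
        (\<lambda>G. real (treewidth G)) \<in> \<Omega>[large_in \<G>](\<lambda>G. ln (ln (real (order_of G)))) \<and>
        (\<lambda>G. real (row_treewidth G)) \<in> \<Omega>[large_in \<G>](\<lambda>G. ln (ln (real (order_of G))))"
    by blast
qed

end
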